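(* Let $d\in\{2,3\}$, let $X=L^2(\mathbb S^{d-1}\times\mathbb S^{d-1})$ (complex-valued), and let $\mathcal X$ be an analytic class as in the context. Let $\mu$ be a Borel probability measure on $X$ and assume there is $M_{\mathcal X}>0$ with $\|f\|_{\mathcal X}\le M_{\mathcal X}$ for $\mu$-a.e. $f$. Then there exist constants $C_1,c_1>0$, independent of $L$, such that for every $L\in\mathbb N$ the spectral synthesis error satisfies $$\varepsilon_{m_L}^{\mathrm{spec}}:=\operatorname*{ess\,sup}_{f\in X}\|\mathcal S_L\mathcal E_L(f)-f\|_{L^2(\mathbb S^{d-1}\times\mathbb S^{d-1})}\le C_1e^{-c_1m_L^{1/(2(d-1))}},$$ the essential supremum being with respect to $\mu$, where $\mathcal E_L$ is the truncated spherical-harmonic coefficient encoder, $\mathcal S_L$ the corresponding linear spectral synthesis operator, and $m_L$ the real encoder dimension. In particular, for $\varepsilon>0$, to guarantee $\varepsilon_{m_L}^{\mathrm{spec}}\le\varepsilon$ it suffices that $$m_L\ge\left(\frac1{c_1}\log\frac{C_1}\varepsilon\right)^{2(d-1)}.$$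
   Context: For $l\ge0$ let $\{Y_{l,j}\}_{1\le j\le d_l}$ be an orthonormal basis of the spherical harmonics of degree $l$ on $\mathbb S^{d-1}$ ($d_l=2l+1$ if $d=3$; for $d=2$ these are the Fourier modes of frequency $\pm l$ on $\mathbb S^1$, $d_0=1$, $d_l=2$ for $l\ge1$). For $f\in X$, $\hat f_{l_1,m_1;l_2,m_2}:=\langle f,Y_{l_1,m_1}(\hat x)Y_{l_2,m_2}(\omega)\rangle_{L^2}$. Analytic class $\mathcal X$: a fixed normed class continuously embedded in $X$ for which there are constants $C,\sigma>0$ with $|\hat f_{l_1,m_1;l_2,m_2}|\le C\|f\|_{\mathcal X}e^{-\sigma(l_1+l_2)}$ for all $f\in\mathcal X$ and all indices. With $r_L:=(\sum_{l=0}^Ld_l)^2$ and $m_L:=2r_L$, the encoder is $\mathcal E_L(f):=(\hat f_{l_1,m_1;l_2,m_2})_{\max(l_1,l_2)\le L}\in\mathbb C^{r_L}\simeq\mathbb R^{m_L}$ (real and imaginary parts separated), and $\mathcal S_L(c):=\sum_{\max(l_1,l_2)\le L}c_{l_1,m_1;l_2,m_2}Y_{l_1,m_1}(\hat x)Y_{l_2,m_2}(\omega)$. *)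

theory Defs
  imports "HOL-Probability.Probability"
begin

section \<open>Surface measure on the unit sphere\<close>

text \<open>
  The (unnormalised) surface measure on the unit sphere of \<open>\<real>\<^sup>d\<close>, obtained as \<open>d\<close> times the
  Lebesgue measure of cones: \<open>\<sigma>(A) = d \<cdot> \<lambda> {t x | 0 < t < 1, x \<in> A}\<close>. The total mass is \<open>2 \<pi>\<close>
  for \<open>d = 2\<close> and \<open>4 \<pi>\<close> for \<open>d = 3\<close>. Here \<open>sgn x = x / norm x\<close>.
\<close>

definition sphere_measure :: "(real^'n) measure" where
  "sphere_measure =
     scale_measure (ennreal (real CARD('n)))
       (distr (restrict_space lborel (ball 0 1 - {0})) (restrict_space borel (sphere 0 1)) sgn)"

abbreviation sphere2_measure :: "((real^'n) \<times> (real^'n)) measure" where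
  "sphere2_measure \<equiv> sphere_measure \<Otimes>\<^sub>M sphere_measure"

lemma space_sphere_measure [simp]: "space sphere_measure = sphere 0 1"
  by (simp add: sphere_measure_def space_restrict_space space_scale_measure)

lemma sets_sphere_measure [simp, measurable_cong]:
  "sets sphere_measure = sets (restrict_space borel (sphere 0 1))"
  by (simp add: sphere_measure_def)

lemma emeasure_sphere_measure:
  fixes A :: "(real^'n) set"
  assumes "A \<in> sets sphere_measure"
  shows "emeasure sphere_measure A =
           ennreal (real CARD('n)) * emeasure lborel {x \<in> ball 0 1 - {0}. sgn x \<in> A}"
proof -
  let ?B = "restrict_space lborel (ball (0 :: real^'n) 1 - {0})"
  have meas: "sgn \<in> ?B \<rightarrow>\<^sub>M restrict_space borel (sphere 0 1)"
  proof (rule measurable_restrict_space2)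
    show "sgn \<in> space ?B \<rightarrow> sphere 0 1"
      by (auto simp: space_restrict_space norm_sgn)
    show "sgn \<in> borel_measurable ?B"
      unfolding sgn_div_norm by (rule measurable_restrict_space1) simp
  qed
  have eq: "sgn -` A \<inter> (ball 0 1 - {0}) = {x \<in> ball 0 1 - {0}. sgn x \<in> A}"
    by auto
  have "emeasure ?B {x \<in> ball 0 1 - {0}. sgn x \<in> A} = emeasure lborel {x \<in> ball 0 1 - {0}. sgn x \<in> A}"
    by (rule emeasure_restrict_space) auto
  then show ?thesis
    using assms meas by (simp add: sphere_measure_def emeasure_distr space_restrict_space eq del: mem_ball Diff_iff)
qed


section \<open>The space of complex-valued square-integrable functions on the product of two spheres\<close>

lemma borel_measurable_cnj [measurable (raw)]:
  "f \<in> borel_measurable M \<Longrightarrow> (\<lambda>x. cnj (f x)) \<in> borel_measurable M"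
  by (rule borel_measurable_continuous_on) (auto intro!: continuous_intros)

definition square_integrable :: "'a measure \<Rightarrow> ('a \<Rightarrow> complex) \<Rightarrow> bool" where
  "square_integrable M f \<longleftrightarrow> f \<in> borel_measurable M \<and> integrable M (\<lambda>x. (cmod (f x))\<^sup>2)"

lemma square_integrable_zero [simp]: "square_integrable M (\<lambda>x. 0)"
  by (simp add: square_integrable_def)

lemma square_integrable_mult_cnj:
  assumes "square_integrable M f" "square_integrable M g"
  shows "integrable M (\<lambda>x. f x * cnj (g x))"
proof (rule Bochner_Integration.integrable_bound)
  show "integrable M (\<lambda>x. (cmod (f x))\<^sup>2 + (cmod (g x))\<^sup>2)"
    using assms by (auto simp: square_integrable_def)
  show "(\<lambda>x. f x * cnj (g x)) \<in> borel_measurable M"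
    using assms by (auto simp: square_integrable_def)
  have "a * b \<le> a\<^sup>2 + b\<^sup>2" if "a \<ge> 0" "b \<ge> 0" for a b :: real
    using sum_squares_bound[of a b] mult_nonneg_nonneg[OF that] by linarith
  then show "AE x in M. norm (f x * cnj (g x)) \<le> norm ((cmod (f x))\<^sup>2 + (cmod (g x))\<^sup>2)"
    by (auto simp: norm_mult)
qed

lemma square_integrable_cmult:
  assumes "square_integrable M f"
  shows "square_integrable M (\<lambda>x. c * f x)"
  using assms by (auto simp: square_integrable_def norm_mult power_mult_distrib)

lemma square_integrable_add:
  assumes "square_integrable M f" "square_integrable M g"
  shows "square_integrable M (\<lambda>x. f x + g x)"
  unfolding square_integrable_def
proof
  show "(\<lambda>x. f x + g x) \<in> borel_measurable M"
    using assms by (auto simp: square_integrable_def)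
  show "integrable M (\<lambda>x. (cmod (f x + g x))\<^sup>2)"
  proof (rule Bochner_Integration.integrable_bound)
    show "integrable M (\<lambda>x. 2 * (cmod (f x))\<^sup>2 + 2 * (cmod (g x))\<^sup>2)"
      using assms by (auto simp: square_integrable_def)
    show "(\<lambda>x. (cmod (f x + g x))\<^sup>2) \<in> borel_measurable M"
      using assms by (auto simp: square_integrable_def)
    have "(cmod (a + b))\<^sup>2 \<le> 2 * (cmod a)\<^sup>2 + 2 * (cmod b)\<^sup>2" for a b
    proof -
      have "(cmod (a + b))\<^sup>2 \<le> (cmod a + cmod b)\<^sup>2"
        by (intro power_mono norm_triangle_ineq) auto
      also have "\<dots> \<le> 2 * (cmod a)\<^sup>2 + 2 * (cmod b)\<^sup>2"
        using sum_squares_bound[of "cmod a" "cmod b"] by (simp add: power2_sum)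
      finally show ?thesis .
    qed
    then show "AE x in M. norm ((cmod (f x + g x))\<^sup>2) \<le> norm (2 * (cmod (f x))\<^sup>2 + 2 * (cmod (g x))\<^sup>2)"
      by auto
  qed
qed

lemma square_integrable_uminus:
  "square_integrable M f \<Longrightarrow> square_integrable M (\<lambda>x. - f x)"
  by (auto simp: square_integrable_def)

lemma square_integrable_diff:
  "square_integrable M f \<Longrightarrow> square_integrable M g \<Longrightarrow> square_integrable M (\<lambda>x. f x - g x)"
  using square_integrable_add[OF _ square_integrable_uminus, of M f g] by simp

definition L2_rel :: "'a measure \<Rightarrow> ('a \<Rightarrow> complex) \<Rightarrow> ('a \<Rightarrow> complex) \<Rightarrow> bool" where
  "L2_rel M f g \<longleftrightarrow> square_integrable M f \<and> square_integrable M g \<and> (AE x in M. f x = g x)"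

lemma part_equivp_L2_rel: "part_equivp (L2_rel M)"
proof (rule part_equivpI)
  show "\<exists>f. L2_rel M f f"
    by (rule exI[of _ "\<lambda>_. 0"]) (simp add: L2_rel_def)
  show "symp (L2_rel M)"
    by (auto intro!: sympI simp: L2_rel_def)
  show "transp (L2_rel M)"
    by (auto intro!: transpI simp: L2_rel_def)
qed

lemma L2_rel_integral_mult_cnj:
  assumes "L2_rel M f f'" "L2_rel M g g'"
  shows "(\<integral>x. f x * cnj (g x) \<partial>M) = (\<integral>x. f' x * cnj (g' x) \<partial>M)"
  using assms by (intro integral_cong_AE) (auto simp: L2_rel_def square_integrable_def)

text \<open>
  For \<^term>\<open>CARD('n) = d\<close>, the type \<open>'n sphere_L2\<close> is the space \<open>X\<close>: square-integrable functions
  modulo almost everywhere equality. As a real inner product space it carries the real part of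
  the complex inner product, so norm and topology (hence \<^term>\<open>borel\<close>) are the usual ones.
\<close>

quotient_type (overloaded) 'n sphere_L2 =
    "(real^('n::finite)) \<times> (real^'n) \<Rightarrow> complex" / partial: "L2_rel sphere2_measure"
  by (rule part_equivp_L2_rel)

lift_definition sphere_L2_cinner :: "'n::finite sphere_L2 \<Rightarrow> 'n sphere_L2 \<Rightarrow> complex" is
  "\<lambda>f g. \<integral>z. f z * cnj (g z) \<partial>sphere2_measure"
  by (rule L2_rel_integral_mult_cnj)

lift_definition sphere_L2_scaleC :: "complex \<Rightarrow> 'n::finite sphere_L2 \<Rightarrow> 'n sphere_L2"
    (infixr "*\<^sub>C" 75) is
  "\<lambda>c f z. c * f z"
  by (auto simp: L2_rel_def square_integrable_cmult)

instantiation sphere_L2 :: (finite) real_inner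
begin

lift_definition zero_sphere_L2 :: "'a sphere_L2" is "\<lambda>_. 0"
  by (simp add: L2_rel_def)

lift_definition plus_sphere_L2 :: "'a sphere_L2 \<Rightarrow> 'a sphere_L2 \<Rightarrow> 'a sphere_L2" is
  "\<lambda>f g z. f z + g z"
  by (auto simp: L2_rel_def square_integrable_add)

lift_definition uminus_sphere_L2 :: "'a sphere_L2 \<Rightarrow> 'a sphere_L2" is "\<lambda>f z. - f z"
  by (auto simp: L2_rel_def square_integrable_uminus)

lift_definition minus_sphere_L2 :: "'a sphere_L2 \<Rightarrow> 'a sphere_L2 \<Rightarrow> 'a sphere_L2" is
  "\<lambda>f g z. f z - g z"
  by (auto simp: L2_rel_def square_integrable_diff)

definition scaleR_sphere_L2 :: "real \<Rightarrow> 'a sphere_L2 \<Rightarrow> 'a sphere_L2" where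
  "scaleR_sphere_L2 r f = complex_of_real r *\<^sub>C f"

definition inner_sphere_L2 :: "'a sphere_L2 \<Rightarrow> 'a sphere_L2 \<Rightarrow> real" where
  "inner_sphere_L2 f g = Re (sphere_L2_cinner f g)"

lift_definition norm_sphere_L2 :: "'a sphere_L2 \<Rightarrow> real" is
  "\<lambda>f. sqrt (\<integral>z. (cmod (f z))\<^sup>2 \<partial>sphere2_measure)"
  by (intro arg_cong[where f = sqrt] integral_cong_AE)
     (auto simp: L2_rel_def square_integrable_def)

definition sgn_sphere_L2 :: "'a sphere_L2 \<Rightarrow> 'a sphere_L2" where
  "sgn_sphere_L2 f = scaleR (inverse (norm f)) f"

definition dist_sphere_L2 :: "'a sphere_L2 \<Rightarrow> 'a sphere_L2 \<Rightarrow> real" where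
  "dist_sphere_L2 f g = norm (f - g)"

definition uniformity_sphere_L2 :: "('a sphere_L2 \<times> 'a sphere_L2) filter" where
  "uniformity_sphere_L2 = (INF e\<in>{0<..}. principal {(x, y). dist x y < e})"

definition open_sphere_L2 :: "'a sphere_L2 set \<Rightarrow> bool" where
  "open_sphere_L2 S \<longleftrightarrow> (\<forall>x\<in>S. \<forall>\<^sub>F (x', y) in uniformity. x' = x \<longrightarrow> y \<in> S)"

lemma Re_cinner_self:
  "Re (sphere_L2_cinner f f) = (norm f)\<^sup>2" for f :: "'a sphere_L2"
proof transfer
  fix f :: "(real^'a) \<times> (real^'a) \<Rightarrow> complex"
  have "(\<integral>z. f z * cnj (f z) \<partial>sphere2_measure) =
        complex_of_real (\<integral>z. (cmod (f z))\<^sup>2 \<partial>sphere2_measure)"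
    by (simp flip: complex_norm_square integral_complex_of_real)
  then show "Re (\<integral>z. f z * cnj (f z) \<partial>sphere2_measure) =
      (sqrt (\<integral>z. (cmod (f z))\<^sup>2 \<partial>sphere2_measure))\<^sup>2"
    by simp
qed

instance
proof
  fix f g h :: "'a sphere_L2" and r s :: real
  show "f + g + h = f + (g + h)"
    by transfer (auto simp: L2_rel_def add.assoc intro!: square_integrable_add)
  show "f + g = g + f"
    by transfer (auto simp: L2_rel_def add.commute intro!: square_integrable_add)
  show "0 + f = f"
    by transfer (auto simp: L2_rel_def)
  show "- f + f = 0"
    by transfer (auto simp: L2_rel_def)
  show "f - g = f + - g"
    by transfer (auto simp: L2_rel_def intro!: square_integrable_diff)
  show "r *\<^sub>R (f + g) = r *\<^sub>R f + r *\<^sub>R g"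
    unfolding scaleR_sphere_L2_def
    by transfer (auto simp: L2_rel_def distrib_left
        intro!: square_integrable_add square_integrable_cmult)
  show "(r + s) *\<^sub>R f = r *\<^sub>R f + s *\<^sub>R f"
    unfolding scaleR_sphere_L2_def
    by transfer (auto simp: L2_rel_def distrib_right
        intro!: square_integrable_add square_integrable_cmult)
  show "r *\<^sub>R s *\<^sub>R f = (r * s) *\<^sub>R f"
    unfolding scaleR_sphere_L2_def
    by transfer (auto simp: L2_rel_def mult.assoc intro!: square_integrable_cmult)
  show "1 *\<^sub>R f = f"
    unfolding scaleR_sphere_L2_def by transfer (auto simp: L2_rel_def)
  show "dist f g = norm (f - g)"
    by (rule dist_sphere_L2_def)
  show "sgn f = scaleR (inverse (norm f)) f"
    by (rule sgn_sphere_L2_def)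
  show "(uniformity :: ('a sphere_L2 \<times> 'a sphere_L2) filter) =
      (INF e\<in>{0<..}. principal {(x, y). dist x y < e})"
    by (rule uniformity_sphere_L2_def)
  show "open U \<longleftrightarrow> (\<forall>x\<in>U. \<forall>\<^sub>F (x', y) in uniformity. x' = x \<longrightarrow> y \<in> U)" for U :: "'a sphere_L2 set"
    by (rule open_sphere_L2_def)
  have "sphere_L2_cinner f g = cnj (sphere_L2_cinner g f)"
    by transfer (simp add: mult.commute Bochner_Integration.integral_cnj[symmetric])
  then show "f \<bullet> g = g \<bullet> f"
    by (simp add: inner_sphere_L2_def)
  have "sphere_L2_cinner (f + g) h = sphere_L2_cinner f h + sphere_L2_cinner g h"
    by transfer (simp add: L2_rel_def distrib_right square_integrable_mult_cnj)
  then show "(f + g) \<bullet> h = f \<bullet> h + g \<bullet> h"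
    by (simp add: inner_sphere_L2_def)
  have "sphere_L2_cinner (complex_of_real r *\<^sub>C f) g = complex_of_real r * sphere_L2_cinner f g"
    by transfer (simp add: L2_rel_def mult.assoc)
  then show "r *\<^sub>R f \<bullet> g = r * (f \<bullet> g)"
    by (simp add: inner_sphere_L2_def scaleR_sphere_L2_def)
  show "0 \<le> f \<bullet> f"
    by (simp add: inner_sphere_L2_def Re_cinner_self)
  have "norm f = 0 \<longleftrightarrow> f = 0"
    by transfer
       (auto simp: L2_rel_def square_integrable_def integral_nonneg_eq_0_iff_AE)
  then show "f \<bullet> f = 0 \<longleftrightarrow> f = 0"
    by (simp add: inner_sphere_L2_def Re_cinner_self)
  have "0 \<le> norm f"
    by transfer simp
  then show "norm f = sqrt (f \<bullet> f)"
    by (simp add: inner_sphere_L2_def Re_cinner_self)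
qed

end


section \<open>Spherical harmonics\<close>

definition partial_deriv :: "'n \<Rightarrow> (real^'n \<Rightarrow> complex) \<Rightarrow> real^'n \<Rightarrow> complex" where
  "partial_deriv i p x = frechet_derivative p (at x) (axis i 1)"

definition laplacian :: "(real^'n \<Rightarrow> complex) \<Rightarrow> real^'n \<Rightarrow> complex" where
  "laplacian p x = (\<Sum>i\<in>UNIV. partial_deriv i (partial_deriv i p) x)"

text \<open>
  Spherical harmonics of degree \<open>l\<close> are the restrictions to the unit sphere of complex harmonic
  polynomials that are homogeneous of degree \<open>l\<close>. Functions on the sphere are represented by
  functions on the whole space, whose values off the sphere are irrelevant.
\<close>

definition spherical_harmonic :: "nat \<Rightarrow> (real^'n \<Rightarrow> complex) \<Rightarrow> bool" where
  "spherical_harmonic l f \<longleftrightarrow>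
     (\<exists>p. polynomial_function p \<and>
          (\<forall>t x. p (t *\<^sub>R x) = of_real t ^ l * p x) \<and>
          (\<forall>x. laplacian p x = 0) \<and>
          (\<forall>x\<in>sphere 0 1. f x = p x))"

text \<open>
  The dimension \<open>d\<^sub>l\<close> of the space of spherical harmonics of degree \<open>l\<close>; only \<open>d = 2\<close> and \<open>d = 3\<close>
  are meant.
\<close>

definition harmonic_dim :: "nat \<Rightarrow> nat \<Rightarrow> nat" where
  "harmonic_dim d l = (if d = 2 then (if l = 0 then 1 else 2) else 2 * l + 1)"

text \<open>
  \<open>Y l j\<close> for \<open>1 \<le> j \<le> d\<^sub>l\<close> is, for every \<open>l\<close>, an orthonormal basis of the spherical harmonics of
  degree \<open>l\<close>, with respect to the inner product of the surface measure.
\<close>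

definition harmonic_basis :: "(nat \<Rightarrow> nat \<Rightarrow> real^'n \<Rightarrow> complex) \<Rightarrow> bool" where
  "harmonic_basis Y \<longleftrightarrow>
     (\<forall>l. let J = {1..harmonic_dim CARD('n) l} in
        (\<forall>j\<in>J. spherical_harmonic l (Y l j)) \<and>
        (\<forall>j\<in>J. \<forall>k\<in>J. (\<integral>x. Y l j x * cnj (Y l k x) \<partial>sphere_measure) = (if j = k then 1 else 0)) \<and>
        (\<forall>f. spherical_harmonic l f \<longrightarrow>
           (\<exists>c. \<forall>x\<in>sphere 0 1. f x = (\<Sum>j\<in>J. c j * Y l j x))))"


section \<open>Coefficients and the analytic class\<close>

type_synonym harmonic_index = "(nat \<times> nat) \<times> (nat \<times> nat)"

text \<open>The class in \<open>X\<close> of the function \<open>(x, \<omega>) \<mapsto> g x * h \<omega>\<close> (used for continuous \<open>g\<close>, \<open>h\<close>).\<close>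

definition tensor_L2 :: "(real^'n \<Rightarrow> complex) \<Rightarrow> (real^'n \<Rightarrow> complex) \<Rightarrow> 'n sphere_L2" where
  "tensor_L2 g h = abs_sphere_L2 (\<lambda>(x, \<omega>). g x * h \<omega>)"

fun basis_L2 :: "(nat \<Rightarrow> nat \<Rightarrow> real^'n \<Rightarrow> complex) \<Rightarrow> harmonic_index \<Rightarrow> 'n sphere_L2" where
  "basis_L2 Y ((l1, m1), (l2, m2)) = tensor_L2 (Y l1 m1) (Y l2 m2)"

definition harmonic_coeff ::
    "(nat \<Rightarrow> nat \<Rightarrow> real^'n \<Rightarrow> complex) \<Rightarrow> 'n sphere_L2 \<Rightarrow> harmonic_index \<Rightarrow> complex" where
  "harmonic_coeff Y f i = sphere_L2_cinner f (basis_L2 Y i)"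

definition complex_normed_subspace :: "'n::finite sphere_L2 set \<Rightarrow> ('n sphere_L2 \<Rightarrow> real) \<Rightarrow> bool" where
  "complex_normed_subspace V N \<longleftrightarrow>
     0 \<in> V \<and>
     (\<forall>f\<in>V. \<forall>g\<in>V. f + g \<in> V \<and> N (f + g) \<le> N f + N g) \<and>
     (\<forall>c. \<forall>f\<in>V. c *\<^sub>C f \<in> V \<and> N (c *\<^sub>C f) = cmod c * N f) \<and>
     (\<forall>f\<in>V. 0 \<le> N f \<and> (N f = 0 \<longleftrightarrow> f = 0))"

text \<open>
  The analytic class is a complex subspace \<open>V\<close> of \<open>X\<close> with a norm \<open>N\<close> of its own (whose values
  outside \<open>V\<close> are irrelevant), such that the inclusion into \<open>X\<close> is continuous and the harmonic
  coefficients decay exponentially.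
\<close>

definition analytic_class ::
    "(nat \<Rightarrow> nat \<Rightarrow> real^'n \<Rightarrow> complex) \<Rightarrow> 'n sphere_L2 set \<Rightarrow> ('n sphere_L2 \<Rightarrow> real) \<Rightarrow> bool" where
  "analytic_class Y V N \<longleftrightarrow>
     complex_normed_subspace V N \<and>
     (\<exists>K>0. \<forall>f\<in>V. norm f \<le> K * N f) \<and>
     (\<exists>C>0. \<exists>\<sigma>>0. \<forall>f\<in>V. \<forall>l1 l2.
        \<forall>m1\<in>{1..harmonic_dim CARD('n) l1}. \<forall>m2\<in>{1..harmonic_dim CARD('n) l2}.
          cmod (harmonic_coeff Y f ((l1, m1), (l2, m2))) \<le> C * N f * exp (- \<sigma> * real (l1 + l2)))"


section \<open>Encoder, synthesis and spectral error\<close>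

definition trunc_indices :: "nat \<Rightarrow> nat \<Rightarrow> harmonic_index set" where
  "trunc_indices d L =
     {((l1, m1), (l2, m2)) | l1 m1 l2 m2. max l1 l2 \<le> L \<and>
        m1 \<in> {1..harmonic_dim d l1} \<and> m2 \<in> {1..harmonic_dim d l2}}"

definition complex_enc_dim :: "nat \<Rightarrow> nat \<Rightarrow> nat" where
  "complex_enc_dim d L = (\<Sum>l\<le>L. harmonic_dim d l)\<^sup>2"

definition real_enc_dim :: "nat \<Rightarrow> nat \<Rightarrow> nat" where
  "real_enc_dim d L = 2 * complex_enc_dim d L"

lemma finite_card_trunc_indices:
  "finite (trunc_indices d L) \<and> card (trunc_indices d L) = complex_enc_dim d L"
proof -
  let ?S = "SIGMA l:{..L}. {1..harmonic_dim d l}"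
  have "trunc_indices d L = ?S \<times> ?S"
    by (auto simp: trunc_indices_def)
  moreover have "finite ?S" "card ?S = (\<Sum>l\<le>L. harmonic_dim d l)"
    by auto
  ultimately show ?thesis
    by (simp add: complex_enc_dim_def card_cartesian_product power2_eq_square)
qed

text \<open>
  The code space is kept in its complex form: tuples of complex numbers indexed by the
  \<^term>\<open>complex_enc_dim d L\<close> truncated indices, a real space of dimension \<^term>\<open>real_enc_dim d L\<close>.
\<close>

definition encoder ::
    "(nat \<Rightarrow> nat \<Rightarrow> real^'n \<Rightarrow> complex) \<Rightarrow> nat \<Rightarrow> 'n sphere_L2 \<Rightarrow> harmonic_index \<Rightarrow> complex" where
  "encoder Y L f = (\<lambda>i\<in>trunc_indices CARD('n) L. harmonic_coeff Y f i)"

definition synthesis ::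
    "(nat \<Rightarrow> nat \<Rightarrow> real^'n \<Rightarrow> complex) \<Rightarrow> nat \<Rightarrow> (harmonic_index \<Rightarrow> complex) \<Rightarrow> 'n sphere_L2" where
  "synthesis Y L c = (\<Sum>i\<in>trunc_indices CARD('n) L. c i *\<^sub>C basis_L2 Y i)"

definition spectral_error ::
    "'n sphere_L2 measure \<Rightarrow> (nat \<Rightarrow> nat \<Rightarrow> real^'n \<Rightarrow> complex) \<Rightarrow> nat \<Rightarrow> ereal" where
  "spectral_error \<mu> Y L = esssup \<mu> (\<lambda>f. ereal (norm (synthesis Y L (encoder Y L f) - f)))"

end

theory Submission
  imports Defs
begin

text \<open>
  The error \<open>S\<^sub>L E\<^sub>L f - f\<close> is the tail of the expansion of \<open>f\<close> in the products of spherical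
  harmonics, and the decay of the coefficients makes the tail over \<open>max l\<^sub>1 l\<^sub>2 > L\<close> of size
  \<open>exp (- \<sigma> L / 2)\<close>, while the \<open>2 (d - 1)\<close>-th root of \<open>m\<^sub>L\<close> is at most linear in \<open>L\<close>. What has to be
  supplied is that the products form a complete orthonormal system. Spherical harmonics of different
  degrees are orthogonal because they belong to different eigenvalues of the sum of the squares of
  the infinitesimal rotations, which are antisymmetric by rotation invariance of the surface
  measure. For completeness, the three-term recurrence for multiplication by a coordinate shows
  that restrictions of polynomials are sums of spherical harmonics, and polynomials are dense in
  \<open>L\<^sup>2\<close> by the Stone-Weierstrass theorem.
\<close>

section \<open>Differential calculus of complex polynomials\<close>

text \<open>\<open>harmonic_basis\<close> provides orthonormality and spanning only within one
  degree. Orthogonality between degrees has to come from the symmetry of the surface measure, and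
  since that measure is defined by cones, its symmetry is reduced to that of Lebesgue measure.
  Calculus on the sphere is replaced by calculus of polynomials on the whole space: there the
  rotations act by x_i \<partial>_j - x_j \<partial>_i, and Euler's relation evaluates the sum of
  their squares. No infinite series is formed in X. The piece of the expansion between L and a
  larger L' is bounded by the sum of its absolute coefficients, uniformly in L'; density and the
  best approximation property then make the error at L' as small as desired. The rate \<sigma> is
  spent as follows. One half pays for summing over all indices and leaves exp (-\<sigma> L / 2). The
  root of m_L is at most 4 L + 2 for both d, so a further factor 4 is lost and c_1 = \<sigma> / 8;
  the offset 2 becomes the factor exp (\<sigma> / 4) of C_1.\<close>

inductive cpoly :: "(real^'n \<Rightarrow> complex) \<Rightarrow> bool" where
  const: "cpoly (\<lambda>x. c)"
| coord: "cpoly (\<lambda>x. of_real (x $ i))"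
| add: "cpoly p \<Longrightarrow> cpoly q \<Longrightarrow> cpoly (\<lambda>x. p x + q x)"
| mult: "cpoly p \<Longrightarrow> cpoly q \<Longrightarrow> cpoly (\<lambda>x. p x * q x)"

lemma cpoly_sum:
  "finite I \<Longrightarrow> (\<And>i. i \<in> I \<Longrightarrow> cpoly (p i)) \<Longrightarrow> cpoly (\<lambda>x. \<Sum>i\<in>I. p i x)"
  by (induction I rule: finite_induct) (auto intro: cpoly.const cpoly.add)

lemma cpoly_cmult: "cpoly p \<Longrightarrow> cpoly (\<lambda>x. c * p x)"
  by (intro cpoly.intros)

lemma cpoly_diff: "cpoly p \<Longrightarrow> cpoly q \<Longrightarrow> cpoly (\<lambda>x. p x - q x)"
  using cpoly.add[OF _ cpoly_cmult[of q "-1"], of p] by simp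

lemma cpoly_cnj: "cpoly p \<Longrightarrow> cpoly (\<lambda>x. cnj (p x))"
  by (induction rule: cpoly.induct) (auto intro: cpoly.intros)

lemma linear_expansion_cart:
  fixes x :: "real^'n" and f :: "real^'n \<Rightarrow> 'b::real_vector"
  assumes "linear f"
  shows "f x = (\<Sum>i\<in>UNIV. x $ i *\<^sub>R f (axis i 1))"
proof -
  have "f x = f (\<Sum>i\<in>UNIV. x $ i *\<^sub>R axis i 1)"
    by (simp add: basis_expansion flip: scalar_mult_eq_scaleR)
  then show ?thesis
    using assms by (simp add: linear_sum linear_cmul)
qed

lemma cpoly_of_real_polynomial:
  fixes r :: "real^'n \<Rightarrow> real"
  assumes "real_polynomial_function r"
  shows "cpoly (\<lambda>x. of_real (r x))"
  using assms
proof (induction rule: real_polynomial_function.induct)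
  case (linear f)
  have "cpoly (\<lambda>x. \<Sum>i\<in>UNIV. of_real (x $ i) * of_real (f (axis i 1)))"
    by (intro cpoly_sum cpoly.intros) auto
  moreover have "(\<lambda>x. of_real (f x)) =
      (\<lambda>x. \<Sum>i\<in>UNIV. of_real (x $ i) * complex_of_real (f (axis i 1)))"
    by (rule ext, subst linear_expansion_cart[OF bounded_linear.linear[OF linear]]) simp
  ultimately show ?case
    by (simp only:)
qed (auto intro: cpoly.intros)

lemma cpoly_polynomial_function: "cpoly p \<Longrightarrow> polynomial_function p"
proof (induction rule: cpoly.induct)
  case (coord i)
  then show ?case
    by (intro polynomial_function_bounded_linear bounded_linear_compose[OF bounded_linear_of_real])
       (rule bounded_linear_vec_nth)
next
  case (mult p q)
  have "real_polynomial_function (\<lambda>x. Re (p x) * Re (q x) - Im (p x) * Im (q x))"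
    "real_polynomial_function (\<lambda>x. Re (p x) * Im (q x) + Im (p x) * Re (q x))"
    using mult.IH by (auto simp: polynomial_function_iff_Basis_inner Basis_complex_def inner_complex_def
        intro!: real_polynomial_function_diff real_polynomial_function.intros(3,4))
  then show ?case
    by (auto simp: polynomial_function_iff_Basis_inner Basis_complex_def inner_complex_def)
qed auto

text \<open>\<open>polynomial_function\<close> is defined through compositions with linear
  functionals and so offers no induction on the complex-valued function itself. \<open>cpoly\<close>
  supplies that induction, which the calculus of partial derivatives rests on.\<close>

lemma polynomial_function_iff_cpoly:
  fixes p :: "real^'n \<Rightarrow> complex"
  shows "polynomial_function p \<longleftrightarrow> cpoly p"
proof
  assume p: "polynomial_function p"
  have "real_polynomial_function (\<lambda>x. Re (p x))" "real_polynomial_function (\<lambda>x. Im (p x))"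
    using p by (auto simp: polynomial_function_iff_Basis_inner Basis_complex_def inner_complex_def)
  then have "cpoly (\<lambda>x. of_real (Re (p x)) + \<i> * of_real (Im (p x)))"
    by (intro cpoly.add cpoly_cmult cpoly_of_real_polynomial)
  then show "cpoly p"
    by (simp flip: complex_eq)
qed (rule cpoly_polynomial_function)

lemma cpoly_differentiable: "cpoly p \<Longrightarrow> p differentiable (at x)"
  using differentiable_at_polynomial_function cpoly_polynomial_function by blast

lemma cpoly_continuous_on: "cpoly p \<Longrightarrow> continuous_on S p"
  by (simp add: continuous_on_polymonial_function cpoly_polynomial_function)

section \<open>Rules for partial derivatives of polynomials\<close>

lemma partial_deriv_eqI:
  "(p has_derivative p') (at x) \<Longrightarrow> partial_deriv i p x = p' (axis i 1)"
  unfolding partial_deriv_def using frechet_derivative_at by metis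

lemma cpoly_has_derivative:
  assumes "cpoly p"
  shows "(p has_derivative (\<lambda>v. \<Sum>i\<in>UNIV. of_real (v $ i) * partial_deriv i p x)) (at x)"
proof -
  have d: "(p has_derivative frechet_derivative p (at x)) (at x)"
    using cpoly_differentiable[OF assms] by (simp flip: frechet_derivative_works)
  have "frechet_derivative p (at x) = (\<lambda>v. \<Sum>i\<in>UNIV. of_real (v $ i) * partial_deriv i p x)"
    by (rule ext, subst linear_expansion_cart[OF has_derivative_linear[OF d]])
       (simp add: partial_deriv_def scaleR_conv_of_real)
  with d show ?thesis by simp
qed

lemma partial_deriv_const [simp]: "partial_deriv i (\<lambda>x. c) = (\<lambda>x. 0)"
  using partial_deriv_eqI[OF has_derivative_const] by auto

lemma partial_deriv_coord [simp]:
  fixes i j :: "'n::finite"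
  shows "partial_deriv i (\<lambda>x. of_real (x $ j)) = (\<lambda>x. if i = j then 1 else 0)"
proof
  fix x :: "real^'n"
  have "((\<lambda>x. complex_of_real (x $ j)) has_derivative (\<lambda>v. of_real (v $ j))) (at x)"
    by (intro bounded_linear_imp_has_derivative bounded_linear_compose[OF bounded_linear_of_real]
        bounded_linear_vec_nth)
  from partial_deriv_eqI[OF this] show
    "partial_deriv i (\<lambda>x. of_real (x $ j)) x = (if i = j then 1 else 0)"
    by (simp add: axis_def)
qed

context
  fixes p q :: "real^'n \<Rightarrow> complex"
  assumes p: "cpoly p" and q: "cpoly q"
begin

lemma partial_deriv_add: "partial_deriv i (\<lambda>x. p x + q x) = (\<lambda>x. partial_deriv i p x + partial_deriv i q x)"
  using partial_deriv_eqI[OF has_derivative_add[OF cpoly_has_derivative[OF p] cpoly_has_derivative[OF q]]]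
  by (auto simp: axis_def if_distrib if_distribR cong: if_cong)

lemma partial_deriv_diff: "partial_deriv i (\<lambda>x. p x - q x) = (\<lambda>x. partial_deriv i p x - partial_deriv i q x)"
  using partial_deriv_eqI[OF has_derivative_diff[OF cpoly_has_derivative[OF p] cpoly_has_derivative[OF q]]]
  by (auto simp: axis_def if_distrib if_distribR cong: if_cong)

lemma partial_deriv_mult:
  "partial_deriv i (\<lambda>x. p x * q x) = (\<lambda>x. p x * partial_deriv i q x + partial_deriv i p x * q x)"
  using partial_deriv_eqI[OF has_derivative_mult[OF cpoly_has_derivative[OF p] cpoly_has_derivative[OF q]]]
  by (auto simp: axis_def if_distrib if_distribR cong: if_cong)

end

lemma partial_deriv_cmult: "cpoly p \<Longrightarrow> partial_deriv i (\<lambda>x. c * p x) = (\<lambda>x. c * partial_deriv i p x)"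
  using partial_deriv_mult[OF cpoly.const] by simp

lemma partial_deriv_cnj:
  "cpoly p \<Longrightarrow> partial_deriv i (\<lambda>x. cnj (p x)) = (\<lambda>x. cnj (partial_deriv i p x))"
  using partial_deriv_eqI[OF bounded_linear.has_derivative[OF bounded_linear_cnj cpoly_has_derivative]]
  by (auto simp: axis_def if_distrib if_distribR cong: if_cong)

lemma partial_deriv_sum:
  "finite I \<Longrightarrow> (\<And>j. j \<in> I \<Longrightarrow> cpoly (p j)) \<Longrightarrow>
    partial_deriv i (\<lambda>x. \<Sum>j\<in>I. p j x) = (\<lambda>x. \<Sum>j\<in>I. partial_deriv i (p j) x)"
  by (induction I rule: finite_induct) (simp_all add: partial_deriv_add cpoly_sum)

lemma cpoly_partial_deriv: "cpoly p \<Longrightarrow> cpoly (partial_deriv i p)"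
  by (induction rule: cpoly.induct)
     (auto simp: partial_deriv_add partial_deriv_mult intro: cpoly.intros)

text \<open>Symmetry of second derivatives is checked on generators: for constants and coordinates
  they vanish, and sums and products preserve the symmetry by the product rule.\<close>

lemma partial_deriv_commute:
  "cpoly p \<Longrightarrow> partial_deriv i (partial_deriv j p) = partial_deriv j (partial_deriv i p)"
  by (induction rule: cpoly.induct)
     (auto simp: partial_deriv_add partial_deriv_mult cpoly_partial_deriv cpoly.intros algebra_simps)

lemmas cpoly_rules = cpoly.intros cpoly_cmult cpoly_diff cpoly_cnj cpoly_partial_deriv

lemmas partial_deriv_rules =
  partial_deriv_add partial_deriv_diff partial_deriv_mult partial_deriv_cmult partial_deriv_cnj


subsection \<open>Euler's relation\<close>

definition homog :: "nat \<Rightarrow> (real^'n \<Rightarrow> complex) \<Rightarrow> bool" where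
  "homog l p \<longleftrightarrow> (\<forall>t x. p (t *\<^sub>R x) = of_real t ^ l * p x)"

lemma homogD: "homog l p \<Longrightarrow> p (t *\<^sub>R x) = of_real t ^ l * p x"
  by (simp add: homog_def)

text \<open>Homogeneity at t = 0, where 0 ^ 0 = 1, shows that \<open>p\<close> is constant.\<close>

lemma homog_0_partial_deriv: "homog 0 p \<Longrightarrow> partial_deriv i p = (\<lambda>x. 0)"
proof -
  assume "homog 0 p"
  then have "p = (\<lambda>x. p 0)"
    by (metis homogD power_0 mult_1 scaleR_zero_left)
  then show ?thesis
    using partial_deriv_const by metis
qed

text \<open>Differentiating p (t x) = t ^ (l + 1) p x in x gives the claim multiplied by t.
  Cancelling t leaves out t = 0, which is recovered by continuity of the difference \<open>g\<close>
  of the two sides.\<close>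

lemma homog_partial_deriv:
  assumes p: "cpoly p" and hom: "homog (Suc l) p"
  shows "homog l (partial_deriv i p)"
  unfolding homog_def
proof (intro allI)
  fix t x
  define g where "g t = partial_deriv i p (t *\<^sub>R x) - of_real t ^ l * partial_deriv i p x" for t :: real
  have cont: "continuous_on UNIV g"
    unfolding g_def
    by (intro continuous_intros
        continuous_on_compose2[OF cpoly_continuous_on[OF cpoly_partial_deriv[OF p], of UNIV]]) auto
  have "g t = 0" if "t \<noteq> 0" for t
  proof -
    have "((\<lambda>x. p (t *\<^sub>R x)) has_derivative
        (\<lambda>v. \<Sum>i\<in>UNIV. of_real ((t *\<^sub>R v) $ i) * partial_deriv i p (t *\<^sub>R x))) (at x)"
      by (rule has_derivative_compose[OF _ cpoly_has_derivative[OF p]]) (auto intro!: derivative_eq_intros)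
    then have "partial_deriv i (\<lambda>x. p (t *\<^sub>R x)) x = of_real t * partial_deriv i p (t *\<^sub>R x)"
      using partial_deriv_eqI by (force simp: axis_def if_distrib if_distribR cong: if_cong)
    moreover have "partial_deriv i (\<lambda>x. p (t *\<^sub>R x)) x = of_real t ^ Suc l * partial_deriv i p x"
      using partial_deriv_cmult[OF p, of i "of_real t ^ Suc l"] by (simp add: homogD[OF hom])
    ultimately show ?thesis
      using that by (simp add: g_def)
  qed
  moreover have "g 0 = 0"
  proof -
    have "(g \<longlongrightarrow> g 0) (at 0)"
      using cont by (simp add: continuous_on_def)
    moreover have "(g \<longlongrightarrow> 0) (at 0)"
      by (rule tendsto_eventually) (auto simp: eventually_at_filter calculation \<open>\<And>t. t \<noteq> 0 \<Longrightarrow> g t = 0\<close>)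
    ultimately show ?thesis
      using tendsto_unique[of "at (0::real)"] by force
  qed
  ultimately have "g t = 0"
    by metis
  then show "partial_deriv i p (t *\<^sub>R x) = of_real t ^ l * partial_deriv i p x"
    by (simp add: g_def)
qed

text \<open>Both sides are the derivative of t \<mapsto> p (t x) at t = 1, once by the chain rule
  and once from homogeneity.\<close>

lemma euler_relation:
  assumes p: "cpoly p" and hom: "homog l p"
  shows "(\<Sum>i\<in>UNIV. of_real (x $ i) * partial_deriv i p x) = of_nat l * p x"
proof -
  have "((\<lambda>t::real. p (t *\<^sub>R x)) has_derivative
      (\<lambda>s. \<Sum>i\<in>UNIV. of_real ((s *\<^sub>R x) $ i) * partial_deriv i p (1 *\<^sub>R x))) (at 1)"
    by (rule has_derivative_compose[OF _ cpoly_has_derivative[OF p]]) (auto intro!: derivative_eq_intros)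
  moreover have "((\<lambda>t::real. p (t *\<^sub>R x)) has_derivative
      (\<lambda>s. of_nat l * (of_real s * of_real 1 ^ (l - 1)) * p x)) (at 1)"
    unfolding homogD[OF hom] by (auto intro!: derivative_eq_intros)
  ultimately show ?thesis
    by (drule_tac has_derivative_unique) (auto dest!: fun_cong[where x = 1])
qed

text \<open>Euler's relation for \<open>p\<close> is differentiated; the product rule contributes
  one extra \<partial>_i p, hence the - 1. The subtraction takes place in the complex numbers and is
  not truncated, so l = 0 is covered.\<close>

lemma euler_relation_partial_deriv:
  assumes p: "cpoly p" and hom: "homog l p"
  shows "(\<Sum>j\<in>UNIV. of_real (x $ j) * partial_deriv j (partial_deriv i p) x) =
    (of_nat l - 1) * partial_deriv i p x"
proof -
  have "(\<lambda>x. \<Sum>j\<in>UNIV. of_real (x $ j) * partial_deriv j p x) = (\<lambda>x. of_nat l * p x)"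
    using euler_relation[OF p hom] by auto
  then have "partial_deriv i (\<lambda>x. \<Sum>j\<in>UNIV. of_real (x $ j) * partial_deriv j p x) x =
      of_nat l * partial_deriv i p x"
    using partial_deriv_cmult[OF p] by simp
  also have "partial_deriv i (\<lambda>x. \<Sum>j\<in>UNIV. of_real (x $ j) * partial_deriv j p x) x =
      (\<Sum>j\<in>UNIV. of_real (x $ j) * partial_deriv j (partial_deriv i p) x) + partial_deriv i p x"
    using p by (simp add: partial_deriv_sum partial_deriv_mult cpoly_rules sum.distrib
        if_distrib[where f = "\<lambda>z. z * w" for w] partial_deriv_commute[of p i] cong: if_cong)
  finally show ?thesis
    by (simp add: algebra_simps)
qed


section \<open>Solid harmonics\<close>

lemma laplacian_diff:
  "cpoly p \<Longrightarrow> cpoly q \<Longrightarrow> laplacian (\<lambda>x. p x - q x) x = laplacian p x - laplacian q x"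
  by (simp add: laplacian_def partial_deriv_rules cpoly_rules sum_subtractf)

lemma laplacian_cmult: "cpoly p \<Longrightarrow> laplacian (\<lambda>x. c * p x) x = c * laplacian p x"
  by (simp add: laplacian_def partial_deriv_rules cpoly_rules sum_distrib_left)

lemma laplacian_cnj: "cpoly p \<Longrightarrow> laplacian (\<lambda>x. cnj (p x)) x = cnj (laplacian p x)"
  by (simp add: laplacian_def partial_deriv_rules cpoly_rules)

lemma laplacian_mult:
  "cpoly p \<Longrightarrow> cpoly q \<Longrightarrow> laplacian (\<lambda>x. p x * q x) x =
     p x * laplacian q x + 2 * (\<Sum>i\<in>UNIV. partial_deriv i p x * partial_deriv i q x) + laplacian p x * q x"
  by (simp add: laplacian_def partial_deriv_rules cpoly_rules sum.distrib
      sum_distrib_left sum_distrib_right algebra_simps)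

lemma laplacian_partial_deriv:
  assumes "cpoly p"
  shows "laplacian (partial_deriv i p) = partial_deriv i (laplacian p)"
proof -
  have "partial_deriv j (partial_deriv j (partial_deriv i p)) =
      partial_deriv i (partial_deriv j (partial_deriv j p))" for j
    using assms by (metis partial_deriv_commute cpoly_partial_deriv)
  then show ?thesis
    using assms by (simp add: laplacian_def[abs_def] partial_deriv_sum cpoly_rules)
qed

definition solid_harmonic :: "nat \<Rightarrow> (real^'n \<Rightarrow> complex) \<Rightarrow> bool" where
  "solid_harmonic l p \<longleftrightarrow> cpoly p \<and> homog l p \<and> (\<forall>x. laplacian p x = 0)"

lemma spherical_harmonic_iff_solid_harmonic:
  "spherical_harmonic l f \<longleftrightarrow> (\<exists>p. solid_harmonic l p \<and> (\<forall>x\<in>sphere 0 1. f x = p x))"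
  by (auto simp: spherical_harmonic_def solid_harmonic_def homog_def polynomial_function_iff_cpoly)

lemma solid_harmonic_const: "solid_harmonic 0 (\<lambda>x. c)"
  by (simp add: solid_harmonic_def homog_def laplacian_def cpoly.const)

lemma solid_harmonic_cmult: "solid_harmonic l p \<Longrightarrow> solid_harmonic l (\<lambda>x. c * p x)"
  by (simp add: solid_harmonic_def homog_def laplacian_cmult cpoly_cmult)

lemma solid_harmonic_cnj: "solid_harmonic l p \<Longrightarrow> solid_harmonic l (\<lambda>x. cnj (p x))"
  by (simp add: solid_harmonic_def homog_def laplacian_cnj cpoly_cnj)

text \<open>The Laplacian commutes with partial derivatives. The truncated \<open>l - 1\<close> is
  correct at l = 0 as well: there the derivative is the zero polynomial, which is homogeneous of
  degree 0.\<close>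

lemma solid_harmonic_partial_deriv:
  assumes "solid_harmonic l p"
  shows "solid_harmonic (l - 1) (partial_deriv i p)"
proof -
  have "homog (l - 1) (partial_deriv i p)"
  proof (cases l)
    case 0
    then show ?thesis
      using assms by (simp add: solid_harmonic_def homog_0_partial_deriv) (simp add: homog_def)
  qed (use assms homog_partial_deriv in \<open>auto simp: solid_harmonic_def\<close>)
  moreover have "laplacian p = (\<lambda>x. 0)"
    using assms by (auto simp: solid_harmonic_def)
  ultimately show ?thesis
    using assms by (simp add: solid_harmonic_def laplacian_partial_deriv cpoly_partial_deriv)
qed

section \<open>The squared norm as a polynomial and the three-term recurrence\<close>

definition norm_sq :: "real^'n \<Rightarrow> complex" where
  "norm_sq x = (\<Sum>i\<in>UNIV. of_real (x $ i) * of_real (x $ i))"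

lemma norm_sq_sphere: "x \<in> sphere 0 1 \<Longrightarrow> norm_sq x = 1"
proof -
  assume "x \<in> sphere 0 1"
  then have "x \<bullet> x = 1"
    by (simp flip: power2_norm_eq_inner)
  moreover have "norm_sq x = of_real (x \<bullet> x)"
    by (simp add: norm_sq_def inner_vec_def)
  ultimately show ?thesis
    by simp
qed

lemma cpoly_norm_sq: "cpoly norm_sq"
  unfolding norm_sq_def[abs_def] by (intro cpoly_sum cpoly.intros) auto

lemma partial_deriv_norm_sq: "partial_deriv i norm_sq = (\<lambda>x. 2 * of_real (x $ i))"
  unfolding norm_sq_def[abs_def]
  by (simp add: partial_deriv_sum partial_deriv_mult cpoly.intros sum.distrib
      if_distrib[where f = "\<lambda>z. z * w" for w] if_distrib[where f = "\<lambda>z. w * z" for w] cong: if_cong)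

lemma laplacian_norm_sq: "laplacian norm_sq x = 2 * of_nat CARD('n)" for x :: "real^'n"
  by (simp add: laplacian_def partial_deriv_norm_sq partial_deriv_cmult cpoly.coord)

lemma homog_norm_sq: "homog 2 norm_sq"
  by (simp add: homog_def norm_sq_def power2_eq_square sum_distrib_left algebra_simps)

lemma laplacian_coord_mult:
  assumes "cpoly p"
  shows "laplacian (\<lambda>x. of_real (x $ i) * p x) x = of_real (x $ i) * laplacian p x + 2 * partial_deriv i p x"
proof -
  have "laplacian (\<lambda>x. of_real (x $ i)) x = 0"
    by (simp add: laplacian_def if_distrib cong: if_cong)
  then show ?thesis
    using assms by (simp add: laplacian_mult cpoly.coord if_distrib[where f = "\<lambda>z. z * w" for w] cong: if_cong)
qed

text \<open>For h harmonic of degree k, the Laplacian of |x|^2 h is (2 d + 4 k) h: the gradient of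
  |x|^2 is 2 x, so the mixed term is Euler's relation for h. Here h = \<partial>_i p and k = l - 1.
  This value fixes the coefficient in the recurrence below.\<close>

lemma laplacian_norm_sq_mult_partial_deriv:
  fixes p :: "real^'n \<Rightarrow> complex"
  assumes "solid_harmonic l p"
  shows "laplacian (\<lambda>x. norm_sq x * partial_deriv i p x) x =
    (2 * of_nat CARD('n) + 4 * (of_nat l - 1)) * partial_deriv i p x"
proof -
  have p: "cpoly p" "homog l p" "cpoly (partial_deriv i p)"
    using assms by (auto simp: solid_harmonic_def cpoly_partial_deriv)
  have "laplacian (partial_deriv i p) x = 0"
    using solid_harmonic_partial_deriv[OF assms] by (simp add: solid_harmonic_def)
  moreover have "(\<Sum>j\<in>UNIV. partial_deriv j norm_sq x * partial_deriv j (partial_deriv i p) x) =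
      2 * ((of_nat l - 1) * partial_deriv i p x)"
    unfolding euler_relation_partial_deriv[OF p(1,2), symmetric]
    by (simp add: partial_deriv_norm_sq sum_distrib_left mult.assoc)
  ultimately show ?thesis
    by (simp add: laplacian_mult[OF cpoly_norm_sq p(3)] laplacian_norm_sq) (simp add: algebra_simps)
qed

text \<open>
  The three-term recurrence: \<open>x\<^sub>i p = q + |x|\<^sup>2 \<partial>\<^sub>i p / (d + 2 l - 2)\<close> with \<open>q\<close> harmonic of degree
  \<open>l + 1\<close>. It replaces the decomposition of homogeneous polynomials into solid harmonics. The
  denominator vanishes only for \<open>d = 2\<close>, \<open>l = 0\<close> (or \<open>d = 1\<close>), and for \<open>l = 0\<close> so does \<open>\<partial>\<^sub>i p\<close>.
\<close>

lemma coord_mult_spherical_harmonic: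
  fixes f :: "real^'n \<Rightarrow> complex"
  assumes f: "spherical_harmonic l f" and d: "CARD('n) \<ge> 2"
  obtains g h where "spherical_harmonic (l + 1) g" "spherical_harmonic (l - 1) h"
    "\<And>x. x \<in> sphere 0 1 \<Longrightarrow> of_real (x $ i) * f x = g x + h x"
proof -
  obtain p where p: "solid_harmonic l p" and fp: "\<And>x. x \<in> sphere 0 1 \<Longrightarrow> f x = p x"
    using f by (auto simp: spherical_harmonic_iff_solid_harmonic)
  have cp: "cpoly p" "cpoly (partial_deriv i p)" and hom: "homog l p"
    using p by (auto simp: solid_harmonic_def cpoly_partial_deriv)
  \<comment> \<open>The value for which \<open>q\<close> is harmonic: the Laplacian of x_i p is 2
    \<partial>_i p, that of |x|^2 \<partial>_i p is 2 (d + 2 l - 2) \<partial>_i p.\<close>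
  define c :: complex where "c = 1 / (of_nat CARD('n) + 2 * of_nat l - 2)"
  define q where "q x = of_real (x $ i) * p x - c * (norm_sq x * partial_deriv i p x)" for x
  have "cpoly q"
    unfolding q_def[abs_def] by (intro cpoly_rules cp cpoly_norm_sq)
  moreover have "homog (l + 1) q"
  proof (cases l)
    case 0
    then show ?thesis
      using hom by (simp add: homog_def q_def homog_0_partial_deriv)
  next
    case (Suc k)
    then have "homog k (partial_deriv i p)"
      using cp hom homog_partial_deriv by blast
    from homogD[OF this] homogD[OF hom] Suc show ?thesis
      by (simp add: homog_def q_def homogD[OF homog_norm_sq] algebra_simps power2_eq_square)
  qed
  moreover have "laplacian q x = 0" for x
  proof -
    have "laplacian q x = 2 * partial_deriv i p x -
        c * (2 * of_nat CARD('n) + 4 * (of_nat l - 1)) * partial_deriv i p x"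
      unfolding q_def[abs_def] using cp p
      by (simp add: laplacian_diff laplacian_cmult laplacian_coord_mult cpoly_rules cpoly_norm_sq
          laplacian_norm_sq_mult_partial_deriv) (simp add: solid_harmonic_def)
    also have "\<dots> = 0"
    proof (cases "l = 0")
      case True
      then show ?thesis
        using hom by (simp add: homog_0_partial_deriv)
    next
      case False
      then have "complex_of_nat (CARD('n) + 2 * l) \<noteq> of_nat 2"
        using d by (subst of_nat_eq_iff) simp
      then show ?thesis
        by (simp add: c_def field_simps)
    qed
    finally show ?thesis .
  qed
  ultimately have "solid_harmonic (l + 1) q"
    by (simp add: solid_harmonic_def)
  moreover have "solid_harmonic (l - 1) (\<lambda>x. c * partial_deriv i p x)"
    by (intro solid_harmonic_cmult solid_harmonic_partial_deriv p)
  moreover have "of_real (x $ i) * f x = q x + c * partial_deriv i p x" if "x \<in> sphere 0 1" for x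
    using that by (simp add: q_def fp norm_sq_sphere)
  ultimately show ?thesis
    using that by (metis spherical_harmonic_iff_solid_harmonic)
qed


subsection \<open>Infinitesimal rotations\<close>

definition rot_deriv :: "'n \<Rightarrow> 'n \<Rightarrow> (real^'n \<Rightarrow> complex) \<Rightarrow> real^'n \<Rightarrow> complex" where
  "rot_deriv i j p x = of_real (x $ i) * partial_deriv j p x - of_real (x $ j) * partial_deriv i p x"

lemma cpoly_rot_deriv: "cpoly p \<Longrightarrow> cpoly (rot_deriv i j p)"
  unfolding rot_deriv_def[abs_def] by (intro cpoly_rules)

lemma rot_deriv_mult:
  "cpoly p \<Longrightarrow> cpoly q \<Longrightarrow>
    rot_deriv i j (\<lambda>x. p x * q x) x = p x * rot_deriv i j q x + rot_deriv i j p x * q x"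
  by (simp add: rot_deriv_def partial_deriv_mult algebra_simps)

text \<open>The term for \<open>i = j\<close> makes the expansion vanish on the diagonal, as the
  operator does, so that the sum may run over all ordered pairs.\<close>

lemma rot_deriv_rot_deriv:
  assumes p: "cpoly p"
  shows "rot_deriv i j (rot_deriv i j p) x =
     of_real (x $ i) * of_real (x $ i) * partial_deriv j (partial_deriv j p) x
   + of_real (x $ j) * of_real (x $ j) * partial_deriv i (partial_deriv i p) x
   - of_real (x $ i) * of_real (x $ j) * partial_deriv i (partial_deriv j p) x
   - of_real (x $ i) * of_real (x $ j) * partial_deriv j (partial_deriv i p) x
   + (if i = j then 2 * (of_real (x $ i) * partial_deriv i p x) else 0)
   - of_real (x $ i) * partial_deriv i p x - of_real (x $ j) * partial_deriv j p x"
  using p unfolding rot_deriv_def[abs_def]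
  by (simp add: partial_deriv_rules cpoly_rules algebra_simps)

text \<open>Over ordered pairs every plane counts twice, so this is twice the spherical Laplacian,
  with twice its eigenvalue - l (l + d - 2). Harmonicity removes the terms with x_i^2 or x_j^2;
  Euler's relation for \<open>p\<close> and for its partial derivatives turns the remaining ones
  into multiples of \<open>p\<close>.\<close>

lemma sum_rot_deriv_solid_harmonic:
  fixes p :: "real^'n \<Rightarrow> complex"
  assumes "solid_harmonic l p"
  shows "(\<Sum>i\<in>UNIV. \<Sum>j\<in>UNIV. rot_deriv i j (rot_deriv i j p) x) =
    - 2 * of_nat l * (of_nat l + of_nat CARD('n) - 2) * p x"
proof -
  have p: "cpoly p" "homog l p" and lap: "laplacian p x = 0"
    using assms by (auto simp: solid_harmonic_def)
  let ?e = "\<lambda>i. complex_of_real (x $ i) * partial_deriv i p x"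
  let ?m = "\<lambda>i j. complex_of_real (x $ i) * of_real (x $ j) * partial_deriv j (partial_deriv i p) x"
  have e: "(\<Sum>i\<in>UNIV. ?e i) = of_nat l * p x"
    by (rule euler_relation[OF p])
  have n: "(\<Sum>i\<in>UNIV. \<Sum>j\<in>UNIV. of_real (x $ i) * of_real (x $ i) * partial_deriv j (partial_deriv j p) x) = 0"
    using lap by (simp add: laplacian_def flip: sum_distrib_left)
  have n': "(\<Sum>i\<in>UNIV. \<Sum>j\<in>UNIV. of_real (x $ j) * of_real (x $ j) * partial_deriv i (partial_deriv i p) x) = 0"
    by (subst sum.swap) (rule n)
  have m: "(\<Sum>i\<in>UNIV. \<Sum>j\<in>UNIV. ?m i j) = (of_nat l - 1) * (of_nat l * p x)"
  proof -
    have "(\<Sum>j\<in>UNIV. ?m i j) = (of_nat l - 1) * ?e i" for i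
      using arg_cong[OF euler_relation_partial_deriv[OF p, of x i], of "\<lambda>z. of_real (x $ i) * z"]
      by (simp add: sum_distrib_left algebra_simps)
    then show ?thesis
      by (simp add: e flip: sum_distrib_left)
  qed
  have m': "(\<Sum>i\<in>UNIV. \<Sum>j\<in>UNIV. of_real (x $ i) * of_real (x $ j) * partial_deriv i (partial_deriv j p) x) =
      (of_nat l - 1) * (of_nat l * p x)"
    unfolding m[symmetric] by (simp add: partial_deriv_commute[OF p(1)])
  have e': "(\<Sum>i\<in>UNIV. of_nat CARD('n) * ?e i) = of_nat CARD('n) * (of_nat l * p x)"
    by (simp add: e flip: sum_distrib_left)
  have e2: "(\<Sum>i\<in>UNIV. 2 * ?e i) = 2 * (of_nat l * p x)"
    by (simp add: e flip: sum_distrib_left)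
  have "(\<Sum>i\<in>UNIV. \<Sum>j\<in>UNIV. rot_deriv i j (rot_deriv i j p) x) =
      - 2 * ((of_nat l - 1) * (of_nat l * p x)) + 2 * (of_nat l * p x)
      - 2 * of_nat CARD('n) * (of_nat l * p x)"
    by (simp add: rot_deriv_rot_deriv[OF p(1)] sum.distrib sum_subtractf sum_negf n n' m m' e e' e2)
  then show ?thesis
    by (simp add: algebra_simps)
qed


section \<open>Rotation invariance and orthogonality\<close>

lemma orthogonal_transformation_borel_measurable:
  fixes R :: "'a::euclidean_space \<Rightarrow> 'a"
  assumes "orthogonal_transformation R"
  shows "R \<in> borel \<rightarrow>\<^sub>M borel"
  using orthogonal_transformation_linear[OF assms]
  by (intro borel_measurable_continuous_onI linear_continuous_on) (simp add: linear_conv_bounded_linear)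

lemma orthogonal_transformation_measurable_sphere:
  fixes R :: "real^'n \<Rightarrow> real^'n"
  assumes "orthogonal_transformation R"
  shows "R \<in> sphere_measure \<rightarrow>\<^sub>M sphere_measure"
proof -
  have "R \<in> restrict_space borel (sphere 0 1) \<rightarrow>\<^sub>M restrict_space borel (sphere 0 1)"
    using assms orthogonal_transformation_borel_measurable[OF assms]
    by (intro measurable_restrict_space2 measurable_restrict_space1)
       (auto simp: space_restrict_space orthogonal_transformation)
  then show ?thesis
    by (simp cong: measurable_cong_sets)
qed

text \<open>
  The image of Lebesgue measure under a linear isometry is again translation invariant. As in the
  uniqueness proof for Haar measure, Fubini's theorem then makes it proportional to Lebesgue
  measure, and the unit ball shows that the factor is 1.
\<close>

lemma lborel_distr_orthogonal_transformation:
  fixes R :: "'a::euclidean_space \<Rightarrow> 'a"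
  assumes R: "orthogonal_transformation R"
  shows "distr lborel borel R = lborel"
proof -
  define M where "M = distr lborel borel R"
  obtain S where S: "orthogonal_transformation S" "\<And>x. R (S x) = x"
    using R by (metis orthogonal_transformation_inv orthogonal_transformation_surj surj_f_inv_f)
  have [measurable]: "R \<in> borel \<rightarrow>\<^sub>M borel" "S \<in> borel \<rightarrow>\<^sub>M borel"
    by (intro orthogonal_transformation_borel_measurable R S)+
  have sets_M [measurable_cong]: "sets M = sets borel"
    by (simp add: M_def)
  have M_ball: "emeasure M (ball 0 1) = emeasure lborel (ball (0 :: 'a) 1)"
  proof -
    have "R -` ball 0 1 = ball 0 1"
      using R by (auto simp: orthogonal_transformation_norm)
    then show ?thesis
      by (simp add: M_def emeasure_distr)
  qed
  have trans_lborel: "(\<integral>\<^sup>+ x. h (x + t) \<partial>lborel) = (\<integral>\<^sup>+ x. h x \<partial>lborel)"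
    if [measurable]: "h \<in> borel_measurable borel" for h and t :: 'a
    using nn_integral_distr[of "(+) t" lborel borel h]
    by (simp add: lborel_distr_plus add.commute)
  have trans_M: "(\<integral>\<^sup>+ x. h (x + t) \<partial>M) = (\<integral>\<^sup>+ x. h x \<partial>M)"
    if [measurable]: "h \<in> borel_measurable borel" for h t
  proof -
    have "R x + t = R (x + S t)" for x
      by (simp add: S linear_add[OF orthogonal_transformation_linear[OF R]])
    then show ?thesis
      using trans_lborel[of "\<lambda>x. h (R x)" "S t"] by (simp add: M_def nn_integral_distr)
  qed
  \<comment> \<open>Pushing \<open>M\<close> forward along the inverse \<open>S\<close> returns
    Lebesgue measure. A measure with a sigma-finite image is sigma-finite, which is what Fubini's
    theorem asks of \<open>M\<close>.\<close>
  have "S (R x) = x" for x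
    using S(2) orthogonal_transformation_inj[OF R] by (metis injD)
  then have "distr M borel S = lborel"
    by (simp add: M_def distr_distr o_def) (simp add: distr_id2)
  then interpret M: sigma_finite_measure M
    using sigma_finite_measure_distr[of M borel S] lborel.sigma_finite_measure_axioms by simp
  interpret P: pair_sigma_finite M lborel ..
  define B where "B = (indicator (ball 0 1) :: 'a \<Rightarrow> ennreal)"
  have [measurable]: "B \<in> borel_measurable borel"
    by (simp add: B_def borel_measurable_indicator)
  have B_lborel: "(\<integral>\<^sup>+ x. B x \<partial>lborel) = emeasure lborel (ball (0::'a) 1)"
    and B_M: "(\<integral>\<^sup>+ x. B x \<partial>M) = emeasure lborel (ball (0::'a) 1)"
    using sets_M by (simp_all add: B_def M_ball)
  have B_minus: "B (- x) = B x" for x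
    by (simp add: B_def indicator_def)
  have "emeasure M A = emeasure lborel A" if A [measurable]: "A \<in> sets borel" for A
  proof -
    define g where "g = (indicator A :: 'a \<Rightarrow> ennreal)"
    have [measurable]: "g \<in> borel_measurable borel"
      by (simp add: g_def borel_measurable_indicator)
    have g: "(\<integral>\<^sup>+ x. g x \<partial>lborel) = emeasure lborel A" "(\<integral>\<^sup>+ x. g x \<partial>M) = emeasure M A"
      using sets_M by (simp_all add: g_def)
    \<comment> \<open>The double integral of g(y) B(x - y) is evaluated in two ways. Translating x
      gives the ball times M(A). Exchanging the integrals, translating y by x under
      \<open>M\<close>, exchanging back and translating x gives lborel(A) times the ball. The ball
      has finite positive measure and cancels.\<close>
    have "emeasure lborel (ball (0::'a) 1) * emeasure M A = (\<integral>\<^sup>+ y. g y * (\<integral>\<^sup>+ x. B x \<partial>lborel) \<partial>M)"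
      by (simp add: nn_integral_multc B_lborel g mult.commute)
    also have "\<dots> = (\<integral>\<^sup>+ y. \<integral>\<^sup>+ x. g y * B (x - y) \<partial>lborel \<partial>M)"
    proof (rule nn_integral_cong)
      fix y
      have "(\<integral>\<^sup>+ x. B (x - y) \<partial>lborel) = (\<integral>\<^sup>+ x. B x \<partial>lborel)"
        using trans_lborel[of B "- y"] by simp
      then show "g y * (\<integral>\<^sup>+ x. B x \<partial>lborel) = (\<integral>\<^sup>+ x. g y * B (x - y) \<partial>lborel)"
        by (subst nn_integral_cmult) simp_all
    qed
    also have "\<dots> = (\<integral>\<^sup>+ x. \<integral>\<^sup>+ y. g y * B (x - y) \<partial>M \<partial>lborel)"
      by (rule P.Fubini'[symmetric]) measurable
    also have "\<dots> = (\<integral>\<^sup>+ x. \<integral>\<^sup>+ y. g (y + x) * B (- y) \<partial>M \<partial>lborel)"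
      using trans_M[of "\<lambda>y. g y * B (x - y)" x for x] by simp
    also have "\<dots> = (\<integral>\<^sup>+ y. \<integral>\<^sup>+ x. g (y + x) * B (- y) \<partial>lborel \<partial>M)"
      by (rule P.Fubini') measurable
    also have "\<dots> = (\<integral>\<^sup>+ y. (\<integral>\<^sup>+ x. g x \<partial>lborel) * B (- y) \<partial>M)"
      using trans_lborel[of g y for y] by (simp add: nn_integral_multc add.commute)
    also have "\<dots> = emeasure lborel A * (\<integral>\<^sup>+ y. B y \<partial>M)"
      by (simp add: nn_integral_cmult g B_minus)
    also have "\<dots> = emeasure lborel (ball (0::'a) 1) * emeasure lborel A"
      by (simp add: B_M mult.commute)
    finally show ?thesis
      using emeasure_lborel_ball_finite[of "0::'a" 1] content_ball_pos[of 1 "0::'a"]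
      by (auto simp: ennreal_mult_cancel_left measure_def)
  qed
  then show ?thesis
    by (intro measure_eqI) (simp_all add: M_def)
qed

section \<open>Integration over the sphere and its rotation invariance\<close>

lemma finite_measure_sphere_measure: "finite_measure (sphere_measure :: (real^'n) measure)"
proof (rule finite_measureI)
  have "space (sphere_measure :: (real^'n) measure) \<in> sets sphere_measure"
    by (rule sets.top)
  then have "emeasure sphere_measure (space sphere_measure :: (real^'n) set) =
      ennreal (real CARD('n)) * emeasure lborel {x \<in> ball 0 1 - {0} :: (real^'n) set. sgn x \<in> sphere 0 1}"
    by (subst emeasure_sphere_measure) auto
  also have "\<dots> \<le> ennreal (real CARD('n)) * emeasure lborel (ball (0 :: real^'n) 1)"
    by (intro mult_left_mono emeasure_mono) auto
  also have "\<dots> < \<infinity>"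
    using emeasure_lborel_ball_finite[of "0 :: real^'n" 1] by (simp add: ennreal_mult_less_top)
  finally show "emeasure sphere_measure (space sphere_measure :: (real^'n) set) \<noteq> \<infinity>"
    by simp
qed

interpretation sphere: finite_measure sphere_measure
  by (rule finite_measure_sphere_measure)

lemma borel_measurable_sphere_measure:
  fixes f :: "real^'n \<Rightarrow> 'b::topological_space"
  assumes "continuous_on (sphere 0 1) f"
  shows "f \<in> borel_measurable sphere_measure"
  using borel_measurable_continuous_on_restrict[OF assms]
  by (simp cong: measurable_cong_sets)

lemma continuous_integrable_sphere_measure:
  fixes f :: "real^'n \<Rightarrow> 'b::{banach, second_countable_topology}"
  assumes "continuous_on (sphere 0 1) f"
  shows "integrable sphere_measure f"
proof -
  have "bounded (f ` sphere 0 1)"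
    by (intro compact_imp_bounded compact_continuous_image assms compact_sphere)
  then obtain B where "\<forall>x\<in>sphere 0 1. norm (f x) \<le> B"
    unfolding bounded_iff by blast
  then show ?thesis
    using borel_measurable_sphere_measure[OF assms]
    by (intro sphere.integrable_const_bound[of _ B]) auto
qed

text \<open>An isometry commutes with \<open>sgn\<close>, so the cone over the preimage of a set is
  the preimage of the cone, and the claim becomes the invariance of Lebesgue measure.\<close>

lemma distr_sphere_measure_orthogonal_transformation:
  fixes R :: "real^'n \<Rightarrow> real^'n"
  assumes R: "orthogonal_transformation R"
  shows "distr sphere_measure sphere_measure R = sphere_measure"
proof (rule measure_eqI)
  have lin: "linear R" and nrm: "\<And>x. norm (R x) = norm x"
    using R by (auto simp: orthogonal_transformation)
  note R_sphere = orthogonal_transformation_measurable_sphere[OF R]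
  fix A assume "A \<in> sets (distr sphere_measure sphere_measure R)"
  then have A: "A \<in> sets sphere_measure"
    by simp
  let ?cone = "\<lambda>A. {x \<in> ball 0 1 - {0}. sgn x \<in> A}"
  have sgn_R: "sgn (R x) = R (sgn x)" for x
    by (simp add: sgn_div_norm nrm linear_cmul[OF lin])
  have R0: "R x = 0 \<longleftrightarrow> x = 0" for x
    by (metis nrm norm_eq_zero)
  have cone: "?cone A \<in> sets borel"
  proof -
    obtain B where B: "B \<in> sets borel" "A = sphere 0 1 \<inter> B"
      using A by (auto simp: sets_restrict_space)
    have "sgn \<in> borel_measurable (borel :: (real^'n) measure)"
      unfolding sgn_div_norm by measurable
    then have "sgn -` B \<in> sets borel"
      using B(1) by (rule measurable_sets_borel)
    moreover have "?cone A = (ball 0 1 - {0}) \<inter> sgn -` B"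
      by (auto simp: B(2) norm_sgn)
    ultimately show ?thesis
      by simp
  qed
  have "emeasure (distr sphere_measure sphere_measure R) A =
      emeasure sphere_measure (R -` A \<inter> sphere 0 1)"
    using A by (simp add: emeasure_distr[OF R_sphere])
  also have "\<dots> = ennreal (real CARD('n)) * emeasure lborel (?cone (R -` A \<inter> sphere 0 1))"
    using measurable_sets[OF R_sphere A] by (simp add: emeasure_sphere_measure)
  also have "?cone (R -` A \<inter> sphere 0 1) = R -` ?cone A"
    by (auto simp: sgn_R nrm R0 norm_sgn)
  also have "emeasure lborel (R -` ?cone A) = emeasure (distr lborel borel R) (?cone A)"
    using cone orthogonal_transformation_borel_measurable[OF R] by (subst emeasure_distr) simp_all
  finally show "emeasure (distr sphere_measure sphere_measure R) A = emeasure sphere_measure A"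
    using A R by (simp add: emeasure_sphere_measure lborel_distr_orthogonal_transformation)
qed simp

lemma integral_sphere_orthogonal_transformation:
  fixes R :: "real^'n \<Rightarrow> real^'n" and f :: "real^'n \<Rightarrow> 'b::{banach, second_countable_topology}"
  assumes R: "orthogonal_transformation R" and f: "f \<in> borel_measurable sphere_measure"
  shows "(\<integral>x. f (R x) \<partial>sphere_measure) = (\<integral>x. f x \<partial>sphere_measure)"
  using integral_distr[OF orthogonal_transformation_measurable_sphere[OF R] f]
  by (simp add: distr_sphere_measure_orthogonal_transformation[OF R])

section \<open>Rotations of a coordinate plane and integration by parts\<close>

definition plane_rot :: "'n \<Rightarrow> 'n \<Rightarrow> real \<Rightarrow> real^'n \<Rightarrow> real^'n" where
  "plane_rot i j t x = x + (cos t - 1) *\<^sub>R (x $ i *\<^sub>R axis i 1 + x $ j *\<^sub>R axis j 1)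
     + sin t *\<^sub>R (x $ i *\<^sub>R axis j 1 - x $ j *\<^sub>R axis i 1)"

lemma plane_rot_0 [simp]: "plane_rot i j 0 x = x"
  by (simp add: plane_rot_def)

text \<open>With \<open>u\<close> the projection of x to the plane and \<open>w\<close> its quarter
  turn, the image is x + (cos t - 1) u + sin t w. Its norm depends only on the products x u = u u =
  w w and x w = u w = 0, which hold since the two axes are distinct.\<close>

lemma orthogonal_transformation_plane_rot:
  fixes i j :: "'n::finite"
  assumes "i \<noteq> j"
  shows "orthogonal_transformation (plane_rot i j t)"
  unfolding orthogonal_transformation
proof (intro conjI allI)
  show "linear (plane_rot i j t)"
    by (intro linearI) (simp_all add: plane_rot_def algebra_simps)
  fix x :: "real^'n"
  define u where "u = x $ i *\<^sub>R axis i 1 + x $ j *\<^sub>R (axis j 1 :: real^'n)"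
  define w where "w = x $ i *\<^sub>R axis j 1 - x $ j *\<^sub>R (axis i 1 :: real^'n)"
  have "axis i (1::real) $ j = 0" "axis j (1::real) $ i = 0"
    using assms by (simp_all add: axis_def)
  then have "x \<bullet> u = u \<bullet> u" "w \<bullet> w = u \<bullet> u" "x \<bullet> w = 0" "u \<bullet> w = 0"
    by (simp_all add: u_def w_def inner_simps inner_axis inner_axis' algebra_simps)
  moreover have "cos t * (cos t * (u \<bullet> u)) + sin t * (sin t * (u \<bullet> u)) = u \<bullet> u"
    by (simp flip: mult.assoc distrib_right)
  ultimately have "plane_rot i j t x \<bullet> plane_rot i j t x = x \<bullet> x"
    unfolding plane_rot_def u_def[symmetric] w_def[symmetric]
    by (simp add: inner_simps inner_commute[of u x] inner_commute[of w x] inner_commute[of w u])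
       (simp add: algebra_simps)
  then show "norm (plane_rot i j t x) = norm x"
    by (simp add: norm_eq_sqrt_inner)
qed


text \<open>The rotating point y has velocity y_i e_j - y_j e_i at all times, and the derivative of
  \<open>p\<close> in this direction is \<open>rot_deriv i j p\<close> at y. Times other than 0
  matter for the mean value estimate below.\<close>

lemma has_derivative_plane_rot:
  fixes i j :: "'n::finite"
  assumes p: "cpoly p" and "i \<noteq> j"
  shows "((\<lambda>t. p (plane_rot i j t x)) has_derivative
    (\<lambda>s. of_real s * rot_deriv i j p (plane_rot i j t x))) (at t)"
proof -
  let ?v = "\<lambda>t. cos t *\<^sub>R (x $ i *\<^sub>R axis j 1 - x $ j *\<^sub>R axis i 1)
      - sin t *\<^sub>R (x $ i *\<^sub>R axis i 1 + x $ j *\<^sub>R (axis j 1 :: real^'n))"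
  have v: "?v t = plane_rot i j t x $ i *\<^sub>R axis j 1 - plane_rot i j t x $ j *\<^sub>R axis i 1"
    using assms(2) by (simp add: plane_rot_def vec_eq_iff axis_def algebra_simps)
  have "((\<lambda>t. plane_rot i j t x) has_derivative (\<lambda>s. s *\<^sub>R ?v t)) (at t)"
    unfolding plane_rot_def by (auto intro!: derivative_eq_intros simp: algebra_simps)
  from has_derivative_compose[OF this cpoly_has_derivative[OF p]]
  have d: "((\<lambda>t. p (plane_rot i j t x)) has_derivative
      (\<lambda>s. \<Sum>k\<in>UNIV. of_real ((s *\<^sub>R ?v t) $ k) * partial_deriv k p (plane_rot i j t x))) (at t)" .
  have sum_term: "of_real ((s *\<^sub>R (a *\<^sub>R axis j 1 - b *\<^sub>R axis i 1)) $ k) * z =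
      (if k = j then of_real s * of_real a * z else 0) - (if k = i then of_real s * of_real b * z else 0)"
    for a b s k and z :: complex
    by (auto simp: axis_def algebra_simps)
  have "(\<Sum>k\<in>UNIV. of_real ((s *\<^sub>R ?v t) $ k) * partial_deriv k p (plane_rot i j t x)) =
      of_real s * rot_deriv i j p (plane_rot i j t x)" for s
    unfolding v rot_deriv_def sum_term by (simp add: sum_subtractf algebra_simps)
  from d[unfolded this] show ?thesis .
qed

text \<open>By invariance the integral of p over the rotated sphere does not depend on the angle, so
  all difference quotients integrate to 0. Their limit along the angles 1 / (n + 1) is
  \<open>rot_deriv i j p\<close>, and dominated convergence passes to the integral.\<close>

lemma integral_rot_deriv:
  fixes p :: "real^'n \<Rightarrow> complex"
  assumes p: "cpoly p"
  shows "(\<integral>x. rot_deriv i j p x \<partial>sphere_measure) = 0"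
proof (cases "i = j")
  case True
  then show ?thesis
    by (simp add: rot_deriv_def)
next
  case False
  note ortho = orthogonal_transformation_plane_rot[OF False]
  have "bounded (rot_deriv i j p ` sphere 0 1)"
    by (intro compact_imp_bounded compact_continuous_image compact_sphere
        cpoly_continuous_on cpoly_rot_deriv p)
  then obtain B where B: "\<forall>x\<in>sphere 0 1. norm (rot_deriv i j p x) \<le> B"
    unfolding bounded_iff by blast
  let ?h = "\<lambda>n. inverse (real (Suc n))"
  let ?q = "\<lambda>n x. (p (plane_rot i j (?h n) x) - p x) / of_real (?h n)"
  have cont: "continuous_on (sphere 0 1) (\<lambda>x. p (plane_rot i j t x))" for t
    using orthogonal_transformation_linear[OF ortho]
    by (intro continuous_on_compose2[OF cpoly_continuous_on[OF p, of UNIV]] linear_continuous_on)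
       (auto simp: linear_conv_bounded_linear)
  have int: "(\<integral>x. ?q n x \<partial>sphere_measure) = 0" for n
  proof -
    have "(\<integral>x. p (plane_rot i j (?h n) x) - p x \<partial>sphere_measure) = 0"
      using integral_sphere_orthogonal_transformation[OF ortho
          borel_measurable_sphere_measure[OF cpoly_continuous_on[OF p]]]
      by (simp add: continuous_integrable_sphere_measure cont cpoly_continuous_on p)
    then show ?thesis
      by simp
  qed
  have "(\<lambda>n. \<integral>x. ?q n x \<partial>sphere_measure) \<longlonglongrightarrow> (\<integral>x. rot_deriv i j p x \<partial>sphere_measure)"
  proof (rule integral_dominated_convergence)
    show "rot_deriv i j p \<in> borel_measurable sphere_measure"
      by (intro borel_measurable_sphere_measure cpoly_continuous_on cpoly_rot_deriv p)
    show "?q n \<in> borel_measurable sphere_measure" for n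
      by (intro borel_measurable_sphere_measure continuous_intros cont cpoly_continuous_on p)
        (simp del: of_nat_Suc)
    show "integrable (sphere_measure :: (real^'n) measure) (\<lambda>x. B)"
      by simp
    show "AE x in sphere_measure. (\<lambda>n. ?q n x) \<longlonglongrightarrow> rot_deriv i j p x"
    proof (rule AE_I2)
      fix x :: "real^'n"
      have lim: "((\<lambda>t. norm (p (plane_rot i j t x) - p x - of_real t * rot_deriv i j p x) / \<bar>t\<bar>) \<longlongrightarrow> 0) (at 0)"
        using has_derivative_plane_rot[OF p False, of x 0] by (simp add: has_derivative_at)
      have "norm (p (plane_rot i j t x) - p x - of_real t * rot_deriv i j p x) / \<bar>t\<bar> =
          norm ((p (plane_rot i j t x) - p x) / of_real t - rot_deriv i j p x)" if "t \<noteq> 0" for t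
      proof -
        have "(p (plane_rot i j t x) - p x) / of_real t - rot_deriv i j p x =
            (p (plane_rot i j t x) - p x - of_real t * rot_deriv i j p x) / of_real t"
          using that by (simp add: diff_divide_distrib)
        then show ?thesis
          by (simp only: norm_divide norm_of_real)
      qed
      then have "\<forall>\<^sub>F t in at 0. norm (p (plane_rot i j t x) - p x - of_real t * rot_deriv i j p x) / \<bar>t\<bar> =
          norm ((p (plane_rot i j t x) - p x) / of_real t - rot_deriv i j p x)"
        unfolding eventually_at_filter by simp
      with lim have "((\<lambda>t. norm ((p (plane_rot i j t x) - p x) / of_real t - rot_deriv i j p x)) \<longlongrightarrow> 0) (at 0)"
        by (rule Lim_transform_eventually)
      then have "((\<lambda>t. (p (plane_rot i j t x) - p x) / of_real t) \<longlongrightarrow> rot_deriv i j p x) (at 0)"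
        unfolding Lim_null[where l = "rot_deriv i j p x"] by (rule tendsto_norm_zero_cancel)
      then show "(\<lambda>n. ?q n x) \<longlonglongrightarrow> rot_deriv i j p x"
        by (rule filterlim_compose) (intro filterlim_atI LIMSEQ_inverse_real_of_nat, auto)
    qed
    show "AE x in sphere_measure. norm (?q n x) \<le> B" for n
    proof (rule AE_I2)
      fix x :: "real^'n" assume "x \<in> space sphere_measure"
      then have x: "plane_rot i j t x \<in> sphere 0 1" for t
        using ortho by (simp add: orthogonal_transformation)
      \<comment> \<open>The orbit of x stays on the sphere, so \<open>B\<close> bounds the
        derivative along all of it and the mean value inequality gives a majorant independent of
        n.\<close>
      have "norm (p (plane_rot i j (?h n) x) - p (plane_rot i j 0 x)) \<le> B * norm (?h n - 0)"
      proof (rule differentiable_bound[of UNIV "\<lambda>t. p (plane_rot i j t x)"])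
        show "onorm (\<lambda>s. of_real s * rot_deriv i j p (plane_rot i j t x)) \<le> B" for t
          using bspec[OF B x] by (intro onorm_le) (simp add: norm_mult mult.commute[of B] mult_left_mono)
      qed (auto intro: has_derivative_plane_rot[OF p False])
      moreover have "0 < ?h n"
        by simp
      ultimately show "norm (?q n x) \<le> B"
        by (simp only: norm_divide norm_of_real real_norm_def abs_of_pos plane_rot_0 diff_0_right pos_divide_le_eq)
    qed
  qed
  then show ?thesis
    unfolding int by (simp add: LIMSEQ_const_iff)
qed

text \<open>Since \<open>rot_deriv\<close> is a derivation with integral 0, it is antisymmetric for
  the bilinear pairing. Moving both of its applications from \<open>p\<close> to \<open>q\<close>
  multiplies the same integral by the eigenvalue of degree l and by that of degree k.\<close>

lemma solid_harmonic_orthogonal: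
  fixes p q :: "real^'n \<Rightarrow> complex"
  assumes p: "solid_harmonic l p" and q: "solid_harmonic k q" and "l \<noteq> k" and d: "CARD('n) \<ge> 2"
  shows "(\<integral>x. p x * q x \<partial>sphere_measure) = 0"
proof -
  have cp: "cpoly p" "cpoly q"
    using p q by (auto simp: solid_harmonic_def)
  have int: "integrable sphere_measure (\<lambda>x. f x * g x)" if "cpoly f" "cpoly g" for f g :: "real^'n \<Rightarrow> complex"
    by (intro continuous_integrable_sphere_measure cpoly_continuous_on cpoly.mult that)
  have antisym: "(\<integral>x. f x * rot_deriv i j g x \<partial>sphere_measure) =
      - (\<integral>x. rot_deriv i j f x * g x \<partial>sphere_measure)"
    if "cpoly f" "cpoly g" for f g :: "real^'n \<Rightarrow> complex" and i j
  proof -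
    have "(\<integral>x. f x * rot_deriv i j g x + rot_deriv i j f x * g x \<partial>sphere_measure) = 0"
      using integral_rot_deriv[OF cpoly.mult[OF that]] by (simp add: rot_deriv_mult that)
    then show ?thesis
      using that by (simp add: int cpoly_rot_deriv add_eq_0_iff2)
  qed
  define ev :: "nat \<Rightarrow> complex" where "ev l = - 2 * of_nat l * (of_nat l + of_nat CARD('n) - 2)" for l
  have "ev l * (\<integral>x. p x * q x \<partial>sphere_measure) =
      (\<integral>x. (\<Sum>i\<in>UNIV. \<Sum>j\<in>UNIV. rot_deriv i j (rot_deriv i j p) x) * q x \<partial>sphere_measure)"
    by (simp add: sum_rot_deriv_solid_harmonic[OF p] ev_def mult.assoc)
  also have "\<dots> = (\<Sum>i\<in>UNIV. \<Sum>j\<in>UNIV. \<integral>x. rot_deriv i j (rot_deriv i j p) x * q x \<partial>sphere_measure)"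
    by (simp add: sum_distrib_right int cp cpoly_rot_deriv)
  also have "\<dots> = (\<Sum>i\<in>UNIV. \<Sum>j\<in>UNIV. \<integral>x. p x * rot_deriv i j (rot_deriv i j q) x \<partial>sphere_measure)"
    by (simp add: antisym cp cpoly_rot_deriv)
  also have "\<dots> = (\<integral>x. p x * (\<Sum>i\<in>UNIV. \<Sum>j\<in>UNIV. rot_deriv i j (rot_deriv i j q) x) \<partial>sphere_measure)"
    by (simp add: sum_distrib_left int cp cpoly_rot_deriv)
  also have "\<dots> = ev k * (\<integral>x. p x * q x \<partial>sphere_measure)"
    by (simp add: sum_rot_deriv_solid_harmonic[OF q] ev_def mult.assoc mult.left_commute[of "p x" for x])
  finally have "ev l = ev k \<or> (\<integral>x. p x * q x \<partial>sphere_measure) = 0"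
    by auto
  moreover have "ev l \<noteq> ev k"
  proof
    assume "ev l = ev k"
    \<comment> \<open>The second factor vanishes only for l + k + d = 2, which d \<ge> 2 and
      distinct degrees exclude.\<close>
    moreover have "ev l - ev k = - 2 * ((of_nat l - of_nat k) * (of_nat (l + k + CARD('n)) - 2))"
      by (simp add: ev_def algebra_simps)
    ultimately have "(of_nat l - of_nat k) * (of_nat (l + k + CARD('n)) - 2 :: complex) = 0"
      by simp
    then have "l = k \<or> of_nat (l + k + CARD('n)) = (of_nat 2 :: complex)"
      by simp
    then have "l + k + CARD('n) = 2"
      using \<open>l \<noteq> k\<close> by (metis of_nat_eq_iff)
    then show False
      using d \<open>l \<noteq> k\<close> by linarith
  qed
  ultimately show ?thesis
    by blast
qed

text \<open>The conjugate of a solid harmonic is a solid harmonic of the same degree, so the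
  bilinear statement yields the Hermitian one.\<close>

lemma spherical_harmonic_orthogonal:
  fixes f g :: "real^'n \<Rightarrow> complex"
  assumes f: "spherical_harmonic l f" and g: "spherical_harmonic k g" and "l \<noteq> k" and "CARD('n) \<ge> 2"
  shows "(\<integral>x. f x * cnj (g x) \<partial>sphere_measure) = 0"
proof -
  obtain p q where p: "solid_harmonic l p" "\<And>x. x \<in> sphere 0 1 \<Longrightarrow> f x = p x"
    and q: "solid_harmonic k q" "\<And>x. x \<in> sphere 0 1 \<Longrightarrow> g x = q x"
    using f g by (auto simp: spherical_harmonic_iff_solid_harmonic)
  have "(\<integral>x. f x * cnj (g x) \<partial>sphere_measure) = (\<integral>x. p x * cnj (q x) \<partial>sphere_measure)"
    by (intro Bochner_Integration.integral_cong) (simp_all add: p q)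
  also have "\<dots> = 0"
    using assms by (intro solid_harmonic_orthogonal[of l _ k] solid_harmonic_cnj p q)
  finally show ?thesis .
qed


section \<open>Approximation in mean square\<close>

lemma square_integrable_cong:
  assumes "square_integrable M f" "\<And>x. x \<in> space M \<Longrightarrow> f x = g x"
  shows "square_integrable M g"
  using assms measurable_cong[of M f g borel]
    Bochner_Integration.integrable_cong[OF refl, of M "\<lambda>x. (cmod (f x))\<^sup>2" "\<lambda>x. (cmod (g x))\<^sup>2"]
  by (simp add: square_integrable_def)

lemma square_integrable_sum:
  "finite I \<Longrightarrow> (\<And>i. i \<in> I \<Longrightarrow> square_integrable M (f i)) \<Longrightarrow> square_integrable M (\<lambda>x. \<Sum>i\<in>I. f i x)"
  by (induction I rule: finite_induct) (auto intro: square_integrable_add)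

lemma square_integrable_dominated:
  assumes "f \<in> borel_measurable M" "integrable M (\<lambda>x. (w x)\<^sup>2)"
    "\<And>x. x \<in> space M \<Longrightarrow> cmod (f x) \<le> (w x :: real)"
  shows "square_integrable M f"
  unfolding square_integrable_def
proof
  show "integrable M (\<lambda>x. (cmod (f x))\<^sup>2)"
    using assms(2) by (rule Bochner_Integration.integrable_bound) (use assms in \<open>auto intro!: power_mono\<close>)
qed fact

lemma integral_norm_sq_add_le:
  assumes "square_integrable M f" "square_integrable M g"
  shows "(\<integral>x. (cmod (f x + g x))\<^sup>2 \<partial>M) \<le> 2 * (\<integral>x. (cmod (f x))\<^sup>2 \<partial>M) + 2 * (\<integral>x. (cmod (g x))\<^sup>2 \<partial>M)"
proof -
  have "(cmod (a + b))\<^sup>2 \<le> 2 * (cmod a)\<^sup>2 + 2 * (cmod b)\<^sup>2" for a b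
  proof -
    have "(cmod (a + b))\<^sup>2 \<le> (cmod a + cmod b)\<^sup>2"
      by (intro power_mono norm_triangle_ineq) auto
    also have "\<dots> \<le> 2 * (cmod a)\<^sup>2 + 2 * (cmod b)\<^sup>2"
      using sum_squares_bound[of "cmod a" "cmod b"] by (simp add: power2_sum)
    finally show ?thesis .
  qed
  then have "(\<integral>x. (cmod (f x + g x))\<^sup>2 \<partial>M) \<le> (\<integral>x. 2 * (cmod (f x))\<^sup>2 + 2 * (cmod (g x))\<^sup>2 \<partial>M)"
    using square_integrable_add[OF assms] assms
    by (intro integral_mono) (auto simp: square_integrable_def)
  also have "\<dots> = 2 * (\<integral>x. (cmod (f x))\<^sup>2 \<partial>M) + 2 * (\<integral>x. (cmod (g x))\<^sup>2 \<partial>M)"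
    using assms by (simp add: square_integrable_def)
  finally show ?thesis .
qed

text \<open>Membership in the mean square closure of \<open>G\<close>, stated for functions rather
  than classes and with squared distances, so that pointwise limits and dominated convergence apply
  directly.\<close>

definition L2_approximable :: "'a measure \<Rightarrow> ('a \<Rightarrow> complex) set \<Rightarrow> ('a \<Rightarrow> complex) \<Rightarrow> bool" where
  "L2_approximable M G f \<longleftrightarrow> square_integrable M f \<and>
     (\<forall>\<epsilon>>0. \<exists>g\<in>G. square_integrable M g \<and> (\<integral>x. (cmod (f x - g x))\<^sup>2 \<partial>M) < \<epsilon>)"

lemma L2_approximableE:
  assumes "L2_approximable M G f" "\<epsilon> > 0"
  obtains g where "g \<in> G" "square_integrable M g" "(\<integral>x. (cmod (f x - g x))\<^sup>2 \<partial>M) < \<epsilon>"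
  using assms unfolding L2_approximable_def by blast

lemma L2_approximable_cong:
  assumes "L2_approximable M G f" "\<And>x. x \<in> space M \<Longrightarrow> f x = g x"
  shows "L2_approximable M G g"
  using assms square_integrable_cong[of M f g]
  by (simp add: L2_approximable_def cong: Bochner_Integration.integral_cong)

text \<open>Since |g - f_n| \<le> 2 w, dominated convergence with majorant 4 w^2 gives convergence
  in mean square, and the closure of \<open>G\<close> is closed under such limits.\<close>

lemma L2_approximable_dominated_limit:
  assumes f: "\<And>n. L2_approximable M G (f n)"
    and lim: "\<And>x. x \<in> space M \<Longrightarrow> (\<lambda>n. f n x) \<longlonglongrightarrow> g x"
    and w: "integrable M (\<lambda>x. (w x :: real)\<^sup>2)"
    and bound: "\<And>n x. x \<in> space M \<Longrightarrow> cmod (f n x) \<le> w x"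
  shows "L2_approximable M G g"
proof -
  have f_sq: "square_integrable M (f n)" for n
    using f by (simp add: L2_approximable_def)
  have g_bound: "cmod (g x) \<le> w x" if "x \<in> space M" for x
    using LIMSEQ_le_const2[OF tendsto_norm[OF lim[OF that]]] bound[OF that] by blast
  have g_sq: "square_integrable M g"
  proof (rule square_integrable_dominated)
    have "f n \<in> borel_measurable M" for n
      using f_sq[of n] by (simp add: square_integrable_def)
    then show "g \<in> borel_measurable M"
      using lim by (rule borel_measurable_LIMSEQ_metric)
  qed (fact w g_bound)+
  have "(\<lambda>n. \<integral>x. (cmod (g x - f n x))\<^sup>2 \<partial>M) \<longlonglongrightarrow> (\<integral>x. 0 \<partial>M)"
  proof (rule integral_dominated_convergence)
    show "integrable M (\<lambda>x. 4 * (w x)\<^sup>2)"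
      using w by simp
    show "(\<lambda>x. (cmod (g x - f n x))\<^sup>2) \<in> borel_measurable M" for n
      using square_integrable_diff[OF g_sq f_sq[of n]] by (auto simp: square_integrable_def)
    show "AE x in M. (\<lambda>n. (cmod (g x - f n x))\<^sup>2) \<longlonglongrightarrow> 0"
    proof (rule AE_I2)
      fix x assume "x \<in> space M"
      from tendsto_power[OF tendsto_norm[OF tendsto_diff[OF tendsto_const[of "g x"] lim[OF this]]], of 2]
      show "(\<lambda>n. (cmod (g x - f n x))\<^sup>2) \<longlonglongrightarrow> 0"
        by simp
    qed
    show "AE x in M. norm ((cmod (g x - f n x))\<^sup>2) \<le> 4 * (w x)\<^sup>2" for n
    proof (rule AE_I2)
      fix x assume x: "x \<in> space M"
      have "cmod (g x - f n x) \<le> 2 * w x"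
        using norm_triangle_ineq4[of "g x" "f n x"] g_bound[OF x] bound[OF x, of n] by linarith
      then have "(cmod (g x - f n x))\<^sup>2 \<le> (2 * w x)\<^sup>2"
        by (intro power_mono) auto
      then show "norm ((cmod (g x - f n x))\<^sup>2) \<le> 4 * (w x)\<^sup>2"
        by (simp add: power_mult_distrib)
    qed
  qed simp
  then have lim0: "(\<lambda>n. \<integral>x. (cmod (g x - f n x))\<^sup>2 \<partial>M) \<longlonglongrightarrow> 0"
    by simp
  have "\<exists>h\<in>G. square_integrable M h \<and> (\<integral>x. (cmod (g x - h x))\<^sup>2 \<partial>M) < \<epsilon>" if \<epsilon>: "\<epsilon> > 0" for \<epsilon>
  proof -
    have "\<forall>\<^sub>F n in sequentially. (\<integral>x. (cmod (g x - f n x))\<^sup>2 \<partial>M) < \<epsilon> / 4"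
      using order_tendstoD(2)[OF lim0, of "\<epsilon> / 4"] \<epsilon> by simp
    then obtain n where n: "(\<integral>x. (cmod (g x - f n x))\<^sup>2 \<partial>M) < \<epsilon> / 4"
      by (auto simp: eventually_sequentially)
    \<comment> \<open>The estimate |a + b|^2 \<le> 2 |a|^2 + 2 |b|^2 doubles each error, hence the
      quarters.\<close>
    obtain h where h: "h \<in> G" "square_integrable M h" "(\<integral>x. (cmod (f n x - h x))\<^sup>2 \<partial>M) < \<epsilon> / 4"
      using L2_approximableE[OF f[of n] divide_pos_pos[OF \<epsilon> zero_less_numeral]] by blast
    show ?thesis
      using integral_norm_sq_add_le[OF square_integrable_diff[OF g_sq f_sq] square_integrable_diff[OF f_sq h(2)], of n n]
        n h by (intro bexI[of _ h]) auto
  qed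
  with g_sq show ?thesis
    by (simp add: L2_approximable_def)
qed

context
  fixes M :: "'a measure" and G :: "('a \<Rightarrow> complex) set"
  assumes fin: "finite_measure M"
    and G_add: "\<And>f g. f \<in> G \<Longrightarrow> g \<in> G \<Longrightarrow> (\<lambda>x. f x + g x) \<in> G"
    and G_cmult: "\<And>c f. f \<in> G \<Longrightarrow> (\<lambda>x. c * f x) \<in> G"
begin

lemma L2_approximable_add:
  assumes f: "L2_approximable M G f" and g: "L2_approximable M G g"
  shows "L2_approximable M G (\<lambda>x. f x + g x)"
  unfolding L2_approximable_def
proof (intro conjI allI impI)
  show "square_integrable M (\<lambda>x. f x + g x)"
    using f g by (intro square_integrable_add) (auto simp: L2_approximable_def)
  fix \<epsilon> :: real assume \<epsilon>: "\<epsilon> > 0"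
  obtain f' where f': "f' \<in> G" "square_integrable M f'" "(\<integral>x. (cmod (f x - f' x))\<^sup>2 \<partial>M) < \<epsilon> / 4"
    using L2_approximableE[OF f divide_pos_pos[OF \<epsilon> zero_less_numeral]] by blast
  obtain g' where g': "g' \<in> G" "square_integrable M g'" "(\<integral>x. (cmod (g x - g' x))\<^sup>2 \<partial>M) < \<epsilon> / 4"
    using L2_approximableE[OF g divide_pos_pos[OF \<epsilon> zero_less_numeral]] by blast
  have "(\<integral>x. (cmod (f x - f' x + (g x - g' x)))\<^sup>2 \<partial>M) < \<epsilon>"
    using integral_norm_sq_add_le[of M "\<lambda>x. f x - f' x" "\<lambda>x. g x - g' x"] f g f' g'
    by (simp add: L2_approximable_def square_integrable_diff)
  then show "\<exists>h\<in>G. square_integrable M h \<and> (\<integral>x. (cmod (f x + g x - h x))\<^sup>2 \<partial>M) < \<epsilon>"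
    using f' g' by (intro bexI[of _ "\<lambda>x. f' x + g' x"] conjI square_integrable_add G_add) (auto simp: algebra_simps)
qed

lemma L2_approximable_cmult:
  assumes f: "L2_approximable M G f"
  shows "L2_approximable M G (\<lambda>x. c * f x)"
  unfolding L2_approximable_def
proof (intro conjI allI impI)
  show "square_integrable M (\<lambda>x. c * f x)"
    using f by (intro square_integrable_cmult) (auto simp: L2_approximable_def)
  fix \<epsilon> :: real assume \<epsilon>: "\<epsilon> > 0"
  \<comment> \<open>The summand 1 covers c = 0 and makes the resulting inequality strict.\<close>
  define \<delta> where "\<delta> = \<epsilon> / ((cmod c)\<^sup>2 + 1)"
  have pos: "(cmod c)\<^sup>2 + 1 > 0"
    by (simp add: add_nonneg_pos)
  then have "\<delta> > 0"
    using \<epsilon> by (simp add: \<delta>_def)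
  moreover have "(cmod c)\<^sup>2 * \<delta> < \<epsilon>"
    using \<epsilon> pos by (simp add: \<delta>_def pos_divide_less_eq algebra_simps)
  ultimately obtain f' where f': "f' \<in> G" "square_integrable M f'" "(\<integral>x. (cmod (f x - f' x))\<^sup>2 \<partial>M) < \<delta>"
    using f by (auto simp: L2_approximable_def)
  have "(\<integral>x. (cmod (c * f x - c * f' x))\<^sup>2 \<partial>M) = (cmod c)\<^sup>2 * (\<integral>x. (cmod (f x - f' x))\<^sup>2 \<partial>M)"
    by (simp add: norm_mult power_mult_distrib flip: right_diff_distrib)
  also have "\<dots> \<le> (cmod c)\<^sup>2 * \<delta>"
    using f' by (intro mult_left_mono) auto
  also note \<open>\<dots> < \<epsilon>\<close>
  finally show "\<exists>h\<in>G. square_integrable M h \<and> (\<integral>x. (cmod (c * f x - h x))\<^sup>2 \<partial>M) < \<epsilon>"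
    using f' by (intro bexI[of _ "\<lambda>x. c * f' x"] conjI square_integrable_cmult G_cmult) auto
qed

lemma L2_approximable_sum:
  assumes "finite I" "L2_approximable M G (\<lambda>x. 0)" "\<And>i. i \<in> I \<Longrightarrow> L2_approximable M G (f i)"
  shows "L2_approximable M G (\<lambda>x. \<Sum>i\<in>I. f i x)"
  using assms by (induction I rule: finite_induct) (auto intro: L2_approximable_add)

text \<open>Dynkin's argument: the sets with approximable indicator are closed under complements, by
  1 minus the indicator, and under countable disjoint unions, as dominated limits of finite sums.
  The majorant 1 is square-integrable because the measure is finite.\<close>

lemma L2_approximable_indicator:
  assumes E: "Int_stable E" "E \<subseteq> Pow (space M)" "sets M = sigma_sets (space M) E"
    and ind: "\<And>A. A \<in> E \<Longrightarrow> L2_approximable M G (indicator A)"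
    and one: "L2_approximable M G (\<lambda>x. 1)"
    and A: "A \<in> sets M"
  shows "L2_approximable M G (indicator A)"
  using E(1,2) A[unfolded E(3)]
proof (induction A rule: sigma_sets_induct_disjoint)
  case (basic A)
  then show ?case by (rule ind)
next
  case empty
  show ?case
    using L2_approximable_cmult[OF one, of 0] by (simp add: indicator_def)
next
  case (compl A)
  show ?case
    using L2_approximable_add[OF one L2_approximable_cmult[OF compl(2), of "-1"]]
    by (rule L2_approximable_cong) (auto simp: indicator_def)
next
  case (union A)
  have "L2_approximable M G (indicator (\<Union>i<n. A i))" for n
  proof (induction n)
    case 0
    show ?case
      using L2_approximable_cmult[OF one, of 0] by (simp add: indicator_def)
  next
    case (Suc n)
    have "A n \<inter> A i = {}" if "i < n" for i
      using disjoint_family_onD[OF \<open>disjoint_family A\<close>, of n i] that by simp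
    then have disj: "A n \<inter> (\<Union>i<n. A i) = {}"
      by blast
    from L2_approximable_add[OF Suc union(3)[of n]] show ?case
      by (rule L2_approximable_cong) (use disj in \<open>auto simp: indicator_def lessThan_Suc\<close>)
  qed
  then show ?case
  proof (rule L2_approximable_dominated_limit[where w = "\<lambda>x. 1"])
    show "integrable M (\<lambda>x. 1\<^sup>2 :: real)"
      using fin by (simp add: finite_measure.integrable_const)
    show "(\<lambda>n. indicator (\<Union>i<n. A i) x) \<longlonglongrightarrow> (indicator (\<Union>i. A i) x :: complex)" for x
      by (rule LIMSEQ_indicator_UN)
  qed (auto simp: indicator_def)
qed

text \<open>\<open>f\<close> is a pointwise limit of simple functions bounded by 2 |f|, and these
  are finite combinations of indicators.\<close>

lemma L2_approximable_square_integrable: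
  assumes E: "Int_stable E" "E \<subseteq> Pow (space M)" "sets M = sigma_sets (space M) E"
    and ind: "\<And>A. A \<in> E \<Longrightarrow> L2_approximable M G (indicator A)"
    and one: "L2_approximable M G (\<lambda>x. 1)"
    and f: "square_integrable M f"
  shows "L2_approximable M G f"
proof -
  have zero: "L2_approximable M G (\<lambda>x. 0)"
    using L2_approximable_cmult[OF one, of 0] by simp
  have "f \<in> borel_measurable M"
    using f by (simp add: square_integrable_def)
  then obtain F where F: "\<And>i. simple_function M (F i)" "\<And>x. x \<in> space M \<Longrightarrow> (\<lambda>i. F i x) \<longlonglongrightarrow> f x"
    "\<And>i x. x \<in> space M \<Longrightarrow> dist (F i x) 0 \<le> 2 * dist (f x) 0"
    using borel_measurable_implies_sequence_metric[of f M 0] by blast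
  have "L2_approximable M G (F i)" for i
  proof (rule L2_approximable_cong)
    show "L2_approximable M G (\<lambda>x. \<Sum>y\<in>F i ` space M. y * indicator (F i -` {y} \<inter> space M) x)"
      using F(1)[of i]
      by (intro L2_approximable_sum zero L2_approximable_cmult L2_approximable_indicator[OF E ind one])
         (auto simp: simple_function_def)
    show "(\<Sum>y\<in>F i ` space M. y * indicator (F i -` {y} \<inter> space M) x) = F i x" if "x \<in> space M" for x
      unfolding simple_function_indicator_representation_banach[OF F(1) that, of i]
      by (rule sum.cong) (auto simp: indicator_def)
  qed
  then show ?thesis
  proof (rule L2_approximable_dominated_limit[where w = "\<lambda>x. 2 * cmod (f x)"])
    show "integrable M (\<lambda>x. (2 * cmod (f x))\<^sup>2)"
      using f by (simp add: square_integrable_def power_mult_distrib)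
  qed (use F in auto)
qed

end


section \<open>Completeness of products of spherical harmonics\<close>

text \<open>This makes continuous functions on the product measurable and lets closed sets serve as
  generator. Measurable rectangles are traces of Borel rectangles; conversely, the inclusion into
  the ambient space is measurable in each component.\<close>

lemma sets_sphere2_measure:
  "sets (sphere2_measure :: ((real^'n) \<times> (real^'n)) measure) =
    sets (restrict_space borel (sphere 0 1 \<times> sphere 0 1))"
proof (rule antisym)
  let ?S = "sphere (0 :: real^'n) 1"
  let ?N = "restrict_space borel (?S \<times> ?S)"
  show "sets (sphere2_measure :: ((real^'n) \<times> (real^'n)) measure) \<subseteq> sets ?N"
  proof -
    have "{a \<times> b | a b. a \<in> sets sphere_measure \<and> b \<in> sets sphere_measure} \<subseteq> sets ?N"
    proof clarsimp
      fix a b :: "(real^'n) set"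
      assume "a \<in> sets (restrict_space borel ?S)" "b \<in> sets (restrict_space borel ?S)"
      then obtain a' b' where "a' \<in> sets borel" "b' \<in> sets borel" "a = ?S \<inter> a'" "b = ?S \<inter> b'"
        by (auto simp: sets_restrict_space)
      then show "a \<times> b \<in> sets ?N"
        by (auto simp: sets_restrict_space intro!: image_eqI[of _ _ "a' \<times> b'"] borel_Times)
    qed
    then have "sigma_sets (space ?N) {a \<times> b | a b. a \<in> sets sphere_measure \<and> b \<in> sets sphere_measure}
        \<subseteq> sets ?N"
      by (rule sets.sigma_sets_subset)
    then show ?thesis
      by (simp add: sets_pair_measure space_restrict_space)
  qed
  show "sets ?N \<subseteq> sets (sphere2_measure :: ((real^'n) \<times> (real^'n)) measure)"
  proof -
    have id: "(\<lambda>x. x) \<in> sphere_measure \<rightarrow>\<^sub>M (borel :: (real^'n) measure)"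
      by (rule borel_measurable_sphere_measure) (rule continuous_on_id)
    have "(\<lambda>z. (fst z, snd z)) \<in> sphere2_measure \<rightarrow>\<^sub>M (borel \<Otimes>\<^sub>M borel :: ((real^'n) \<times> (real^'n)) measure)"
      using measurable_compose[OF measurable_fst id] measurable_compose[OF measurable_snd id]
      by (rule measurable_Pair)
    then have "(\<lambda>z. z) \<in> sphere2_measure \<rightarrow>\<^sub>M (borel :: ((real^'n) \<times> (real^'n)) measure)"
      by (simp add: borel_prod)
    from measurable_sets[OF this] show ?thesis
      by (auto simp: sets_restrict_space space_pair_measure Int_commute)
  qed
qed

lemma space_sphere2_measure: "space sphere2_measure = sphere 0 1 \<times> sphere 0 1"
  by (simp add: space_pair_measure)

lemma finite_measure_sphere2_measure: "finite_measure sphere2_measure"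
  by (intro finite_measure_pair_measure finite_measure_sphere_measure)

interpretation sphere2: finite_measure sphere2_measure
  by (rule finite_measure_sphere2_measure)

interpretation sphere2: pair_sigma_finite sphere_measure sphere_measure
  by unfold_locales

lemma continuous_square_integrable_sphere2:
  assumes "continuous_on (sphere 0 1 \<times> sphere 0 1) f"
  shows "square_integrable sphere2_measure f"
proof -
  have "bounded (f ` (sphere 0 1 \<times> sphere 0 1))"
    by (intro compact_imp_bounded compact_continuous_image assms compact_Times compact_sphere)
  then obtain B where B: "\<forall>x\<in>sphere 0 1 \<times> sphere 0 1. norm (f x) \<le> B"
    unfolding bounded_iff by blast
  show ?thesis
  proof (rule square_integrable_dominated)
    show "f \<in> borel_measurable sphere2_measure"
      using borel_measurable_continuous_on_restrict[OF assms]
      by (simp add: measurable_cong_sets[OF sets_sphere2_measure refl])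
    show "integrable sphere2_measure (\<lambda>x. B\<^sup>2)"
      by simp
    show "cmod (f x) \<le> B" if "x \<in> space sphere2_measure" for x
      using B that unfolding space_sphere2_measure by blast
  qed
qed

lemma spherical_harmonic_continuous_on:
  assumes "spherical_harmonic l f"
  shows "continuous_on (sphere 0 1) f"
proof -
  obtain p where "cpoly p" "\<And>x. x \<in> sphere 0 1 \<Longrightarrow> f x = p x"
    using assms by (auto simp: spherical_harmonic_iff_solid_harmonic solid_harmonic_def)
  from cpoly_continuous_on[OF this(1)] show ?thesis
    by (rule continuous_on_eq) (simp add: \<open>\<And>x. x \<in> sphere 0 1 \<Longrightarrow> f x = p x\<close>)
qed

section \<open>Finite sums of products of spherical harmonics\<close>

lemma continuous_on_tensor:
  fixes f g :: "'a::topological_space \<Rightarrow> complex"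
  assumes "continuous_on S f" "continuous_on S g"
  shows "continuous_on (S \<times> S) (\<lambda>(x, y). f x * g y)"
  unfolding case_prod_unfold
  by (intro continuous_intros continuous_on_compose2[OF assms(1)] continuous_on_compose2[OF assms(2)]) auto

text \<open>Equality is demanded on the product of spheres only, because the recurrence holds only
  there. Scalars need no rule of their own, being absorbed into the first factor.\<close>

inductive tensor_span :: "((real^'n) \<times> (real^'n) \<Rightarrow> complex) \<Rightarrow> bool" where
  prod: "spherical_harmonic l f \<Longrightarrow> spherical_harmonic k g \<Longrightarrow>
    (\<And>x y. x \<in> sphere 0 1 \<Longrightarrow> y \<in> sphere 0 1 \<Longrightarrow> F (x, y) = f x * g y) \<Longrightarrow> tensor_span F"
| add: "tensor_span F \<Longrightarrow> tensor_span G \<Longrightarrow>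
    (\<And>z. z \<in> sphere 0 1 \<times> sphere 0 1 \<Longrightarrow> H z = F z + G z) \<Longrightarrow> tensor_span H"

lemma tensor_span_continuous_on:
  "tensor_span F \<Longrightarrow> continuous_on (sphere 0 1 \<times> sphere 0 1) F"
proof (induction rule: tensor_span.induct)
  case (prod l f k g F)
  from continuous_on_tensor[OF this(1,2)[THEN spherical_harmonic_continuous_on]] show ?case
    by (rule continuous_on_eq) (auto simp: prod)
next
  case (add F G H)
  from continuous_on_add[OF add.IH] show ?case
    by (rule continuous_on_eq) (simp add: add)
qed

lemma spherical_harmonic_cmult: "spherical_harmonic l f \<Longrightarrow> spherical_harmonic l (\<lambda>x. c * f x)"
  unfolding spherical_harmonic_iff_solid_harmonic using solid_harmonic_cmult by (metis (no_types, lifting))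

lemma tensor_span_const: "tensor_span (\<lambda>z. c)"
proof -
  have "spherical_harmonic 0 (\<lambda>x. c)" "spherical_harmonic 0 (\<lambda>x. 1)"
    using solid_harmonic_const by (auto simp: spherical_harmonic_iff_solid_harmonic)
  then show ?thesis
    by (rule tensor_span.prod) simp
qed

lemma tensor_span_cmult: "tensor_span F \<Longrightarrow> tensor_span (\<lambda>z. c * F z)"
proof (induction rule: tensor_span.induct)
  case (prod l f k g F)
  then show ?case
    by (intro tensor_span.prod[of l "\<lambda>x. c * f x" k g] spherical_harmonic_cmult) auto
next
  case (add F G H)
  then show ?case
    by (intro tensor_span.add[OF add.IH]) (simp add: algebra_simps)
qed

lemma tensor_span_add: "tensor_span F \<Longrightarrow> tensor_span G \<Longrightarrow> tensor_span (\<lambda>z. F z + G z)"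
  by (rule tensor_span.add) auto

lemma tensor_span_sum:
  "finite I \<Longrightarrow> (\<And>i. i \<in> I \<Longrightarrow> tensor_span (F i)) \<Longrightarrow> tensor_span (\<lambda>z. \<Sum>i\<in>I. F i z)"
  by (induction I rule: finite_induct) (auto intro: tensor_span_const tensor_span_add)

context
  assumes d: "CARD('n::finite) \<ge> 2"
begin

lemma tensor_span_fst_coord_mult:
  fixes F :: "(real^'n) \<times> (real^'n) \<Rightarrow> complex"
  shows "tensor_span F \<Longrightarrow> tensor_span (\<lambda>z. of_real (fst z $ i) * F z)"
proof (induction rule: tensor_span.induct)
  case (prod l f k g F)
  obtain f1 f2 where f12: "spherical_harmonic (l + 1) f1" "spherical_harmonic (l - 1) f2"
    "\<And>x. x \<in> sphere 0 1 \<Longrightarrow> of_real (x $ i) * f x = f1 x + f2 x"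
    using coord_mult_spherical_harmonic[OF prod(1) d, of i] by blast
  have "tensor_span (\<lambda>z. f1 (fst z) * g (snd z))" "tensor_span (\<lambda>z. f2 (fst z) * g (snd z))"
    by (rule tensor_span.prod[OF f12(1) prod(2)] tensor_span.prod[OF f12(2) prod(2)]; simp)+
  then show ?case
    by (rule tensor_span.add) (auto simp: prod(3) f12(3) simp flip: mult.assoc distrib_right)
next
  case (add F G H)
  then show ?case
    by (intro tensor_span.add[OF add.IH]) (simp add: algebra_simps)
qed

lemma tensor_span_snd_coord_mult:
  fixes F :: "(real^'n) \<times> (real^'n) \<Rightarrow> complex"
  shows "tensor_span F \<Longrightarrow> tensor_span (\<lambda>z. of_real (snd z $ i) * F z)"
proof (induction rule: tensor_span.induct)
  case (prod l f k g F)
  obtain g1 g2 where g12: "spherical_harmonic (k + 1) g1" "spherical_harmonic (k - 1) g2"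
    "\<And>x. x \<in> sphere 0 1 \<Longrightarrow> of_real (x $ i) * g x = g1 x + g2 x"
    using coord_mult_spherical_harmonic[OF prod(2) d, of i] by blast
  have "tensor_span (\<lambda>z. f (fst z) * g1 (snd z))" "tensor_span (\<lambda>z. f (fst z) * g2 (snd z))"
    by (rule tensor_span.prod[OF prod(1) g12(1)] tensor_span.prod[OF prod(1) g12(2)]; simp)+
  then show ?case
    by (rule tensor_span.add)
       (auto simp: prod(3) g12(3) mult.left_commute[of _ "f x" for x] simp flip: distrib_left)
next
  case (add F G H)
  then show ?case
    by (intro tensor_span.add[OF add.IH]) (simp add: algebra_simps)
qed

text \<open>Stability under multiplication is proved instead of membership: for a product r s the
  hypothesis for r is applied to s F, whence the arbitrary \<open>F\<close>. Membership of
  polynomials then follows by multiplying constants.\<close>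

lemma tensor_span_real_polynomial_mult:
  fixes r :: "(real^'n) \<times> (real^'n) \<Rightarrow> real"
  shows "real_polynomial_function r \<Longrightarrow> tensor_span F \<Longrightarrow> tensor_span (\<lambda>z. of_real (r z) * F z)"
proof (induction arbitrary: F rule: real_polynomial_function.induct)
  case (linear h)
  have "linear (\<lambda>x :: real^'n. (x, 0 :: real^'n))" "linear (\<lambda>x :: real^'n. (0 :: real^'n, x))"
    by (simp_all add: linear_iff)
  note expand = this[THEN linear_compose, OF bounded_linear.linear[OF linear.hyps], unfolded o_def,
      THEN linear_expansion_cart]
  have h_eq: "h z = (\<Sum>i\<in>UNIV. fst z $ i * h (axis i 1, 0)) + (\<Sum>i\<in>UNIV. snd z $ i * h (0, axis i 1))" for z
  proof -
    have "h z = h (fst z, 0) + h (0, snd z)"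
      using linear_add[OF bounded_linear.linear[OF linear.hyps], of "(fst z, 0)" "(0, snd z)"] by simp
    then show ?thesis
      using expand(1)[of "fst z"] expand(2)[of "snd z"] by simp
  qed
  have eq: "(\<lambda>z. of_real (h z) * F z) =
      (\<lambda>z. (\<Sum>i\<in>UNIV. of_real (h (axis i 1, 0)) * (of_real (fst z $ i) * F z))
         + (\<Sum>i\<in>UNIV. of_real (h (0, axis i 1)) * (of_real (snd z $ i) * F z)))"
    by (rule ext, subst h_eq) (simp add: distrib_left distrib_right sum_distrib_left sum_distrib_right mult_ac)
  show ?case
    unfolding eq using linear.prems
    by (intro tensor_span_add tensor_span_sum tensor_span_cmult tensor_span_fst_coord_mult
        tensor_span_snd_coord_mult) auto
next
  case (const c)
  then show ?case
    by (rule tensor_span_cmult)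
next
  case (add r s)
  from tensor_span_add[OF add.IH(1)[OF add.prems] add.IH(2)[OF add.prems]] show ?case
    by (simp add: algebra_simps)
next
  case (mult r s)
  from mult.IH(1)[OF mult.IH(2)[OF mult.prems]] show ?case
    by (simp add: algebra_simps)
qed

lemma tensor_span_polynomial_function:
  fixes P :: "(real^'n) \<times> (real^'n) \<Rightarrow> complex"
  assumes "polynomial_function P"
  shows "tensor_span P"
proof -
  have "real_polynomial_function (\<lambda>x. Re (P x))" "real_polynomial_function (\<lambda>x. Im (P x))"
    using assms by (auto simp: polynomial_function_iff_Basis_inner Basis_complex_def inner_complex_def)
  then have "tensor_span (\<lambda>z. of_real (Re (P z)) * 1 + of_real (Im (P z)) * \<i>)"
    by (intro tensor_span_add tensor_span_real_polynomial_mult tensor_span_const)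
  then show ?thesis
    by (simp add: complex_eq[symmetric] mult.commute)
qed

lemma L2_approximable_continuous:
  fixes f :: "(real^'n) \<times> (real^'n) \<Rightarrow> complex"
  assumes f: "continuous_on (sphere 0 1 \<times> sphere 0 1) f"
  shows "L2_approximable sphere2_measure (Collect tensor_span) f"
  unfolding L2_approximable_def
proof (intro conjI allI impI)
  show "square_integrable sphere2_measure f"
    by (rule continuous_square_integrable_sphere2[OF f])
  fix \<epsilon> :: real assume "\<epsilon> > 0"
  let ?m = "measure sphere2_measure (space (sphere2_measure :: ((real^'n) \<times> (real^'n)) measure))"
  \<comment> \<open>A uniform error below \<delta> has squared integral at most \<delta>^2 times the
    total mass; the summand 1 makes this strictly less than \<epsilon>.\<close>
  define \<delta> where "\<delta> = sqrt (\<epsilon> / (?m + 1))"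
  have m: "?m + 1 > 0"
    using measure_nonneg[of sphere2_measure] by (simp add: add_nonneg_pos)
  then have \<delta>: "\<delta> > 0" "\<delta>\<^sup>2 = \<epsilon> / (?m + 1)"
    using \<open>\<epsilon> > 0\<close> by (auto simp: \<delta>_def)
  obtain g where g: "polynomial_function g" "\<forall>x\<in>sphere 0 1 \<times> sphere 0 1. norm (f x - g x) < \<delta>"
    using Stone_Weierstrass_polynomial_function[OF _ f \<delta>(1)] compact_Times compact_sphere by blast
  have span: "tensor_span g"
    using g(1) by (rule tensor_span_polynomial_function)
  then have g_sq: "square_integrable sphere2_measure g"
    by (intro continuous_square_integrable_sphere2 tensor_span_continuous_on)
  have "(\<integral>x. (cmod (f x - g x))\<^sup>2 \<partial>sphere2_measure) \<le> (\<integral>x. \<delta>\<^sup>2 \<partial>(sphere2_measure :: ((real^'n) \<times> (real^'n)) measure))"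
    using square_integrable_diff[OF continuous_square_integrable_sphere2[OF f] g_sq] g(2)
    by (intro integral_mono) (auto simp: square_integrable_def space_sphere2_measure less_imp_le intro!: power_mono)
  also have "\<dots> = ?m / (?m + 1) * \<epsilon>"
    by (simp add: \<delta>)
  also have "\<dots> < \<epsilon>"
    using m \<open>\<epsilon> > 0\<close> by (simp add: field_simps)
  finally show "\<exists>g\<in>Collect tensor_span. square_integrable sphere2_measure g \<and>
      (\<integral>x. (cmod (f x - g x))\<^sup>2 \<partial>sphere2_measure) < \<epsilon>"
    using span g_sq by blast
qed

text \<open>The continuous functions max 0 (1 - n dist (z, C)) decrease pointwise to the indicator
  of the closed set.\<close>

lemma L2_approximable_closed:
  fixes C :: "((real^'n) \<times> (real^'n)) set"
  assumes C: "closed C"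
  shows "L2_approximable sphere2_measure (Collect tensor_span) (indicator ((sphere 0 1 \<times> sphere 0 1) \<inter> C))"
proof (cases "C = {}")
  \<comment> \<open>The distance \<open>infdist\<close> to the empty set is 0, so the approximants
    used below would tend to 1 instead.\<close>
  case True
  then show ?thesis
    using L2_approximable_continuous[of "\<lambda>z. 0"] by (simp add: indicator_def[abs_def])
next
  case False
  define \<phi> :: "nat \<Rightarrow> (real^'n) \<times> (real^'n) \<Rightarrow> complex" where
    "\<phi> n z = of_real (max 0 (1 - real n * infdist z C))" for n z
  have "L2_approximable sphere2_measure (Collect tensor_span) (\<phi> n)" for n
    unfolding \<phi>_def[abs_def] by (intro L2_approximable_continuous continuous_intros)
  then show ?thesis
  proof (rule L2_approximable_dominated_limit[where w = "\<lambda>x. 1"])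
    show "integrable (sphere2_measure :: ((real^'n) \<times> (real^'n)) measure) (\<lambda>x. 1\<^sup>2 :: real)"
      by simp
    show "cmod (\<phi> n z) \<le> 1" for n z
      by (simp add: \<phi>_def infdist_nonneg)
    show "(\<lambda>n. \<phi> n z) \<longlonglongrightarrow> indicator (sphere 0 1 \<times> sphere 0 1 \<inter> C) z"
      if z: "z \<in> space sphere2_measure" for z
    proof (cases "z \<in> C")
      case True
      with z show ?thesis
        by (simp add: \<phi>_def space_sphere2_measure)
    next
      case False
      then have "infdist z C > 0"
        using C \<open>C \<noteq> {}\<close> by (metis in_closed_iff_infdist_zero infdist_nonneg order_le_less)
      then obtain N where "1 < real N * infdist z C"
        using reals_Archimedean3 by blast
      then have "\<phi> n z = 0" if "n \<ge> N" for n
      proof -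
        have "real N * infdist z C \<le> real n * infdist z C"
          using that by (intro mult_right_mono infdist_nonneg) auto
        with \<open>1 < real N * infdist z C\<close> show ?thesis
          by (simp add: \<phi>_def max_def)
      qed
      then have "(\<lambda>n. \<phi> n z) \<longlonglongrightarrow> 0"
        by (intro tendsto_eventually) (auto simp: eventually_sequentially)
      with False show ?thesis
        by simp
    qed
  qed
qed

theorem tensor_span_dense:
  fixes f :: "(real^'n) \<times> (real^'n) \<Rightarrow> complex"
  assumes f: "square_integrable sphere2_measure f"
  shows "L2_approximable sphere2_measure (Collect tensor_span) f"
proof (rule L2_approximable_square_integrable[where E = "(\<inter>) (sphere 0 1 \<times> sphere 0 1) ` Collect closed"])
  let ?S = "sphere (0 :: real^'n) 1 \<times> sphere (0 :: real^'n) 1"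
  show "Int_stable ((\<inter>) ?S ` Collect closed)"
  proof (rule Int_stableI_image)
    fix a b :: "((real^'n) \<times> (real^'n)) set" assume "a \<in> Collect closed" "b \<in> Collect closed"
    then show "\<exists>c\<in>Collect closed. ?S \<inter> a \<inter> (?S \<inter> b) = ?S \<inter> c"
      by (intro bexI[of _ "a \<inter> b"]) auto
  qed
  have "closed ?S"
    by (intro closed_Times closed_sphere)
  then have "?S \<in> sigma_sets UNIV (Collect closed)"
    by (intro sigma_sets.Basic) simp
  from sigma_sets_Int[OF this]
  show "sets sphere2_measure = sigma_sets (space sphere2_measure) ((\<inter>) ?S ` Collect closed)"
    by (simp add: sets_sphere2_measure space_sphere2_measure sets_restrict_space borel_eq_closed)
  show "L2_approximable sphere2_measure (Collect tensor_span) (\<lambda>x :: (real^'n) \<times> (real^'n). 1)"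
    by (intro L2_approximable_continuous continuous_on_const)
qed (auto simp: space_sphere2_measure f tensor_span_add tensor_span_cmult finite_measure_sphere2_measure
      intro: L2_approximable_closed)

end


section \<open>The complex structure of the \<open>L\<^sup>2\<close> space\<close>

lemma L2_rel_refl_iff: "L2_rel M f f \<longleftrightarrow> square_integrable M f"
  by (simp add: L2_rel_def)

lemma sphere_L2_cases:
  fixes u :: "'n::finite sphere_L2"
  obtains f where "square_integrable sphere2_measure f" "u = abs_sphere_L2 f"
proof (induction u rule: sphere_L2.abs_induct)
  case (1 f)
  then show ?case
    by (simp add: L2_rel_refl_iff)
qed

lemma abs_sphere_L2_cong:
  assumes "square_integrable sphere2_measure f"
    and "\<And>x y. x \<in> sphere 0 1 \<Longrightarrow> y \<in> sphere 0 1 \<Longrightarrow> f (x, y) = g (x, y)"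
  shows "abs_sphere_L2 f = abs_sphere_L2 g"
proof (rule Quotient3_rel_abs[OF Quotient3_sphere_L2])
  have eq: "f z = g z" if "z \<in> space sphere2_measure" for z
    using that assms(2) by (auto simp: space_sphere2_measure)
  then show "L2_rel sphere2_measure f g"
    using assms(1) square_integrable_cong[OF assms(1) eq] by (simp add: L2_rel_def AE_I2)
qed

lemma inner_scaleC_right:
  fixes u v :: "'a::finite sphere_L2"
  shows "inner u (c *\<^sub>C v) = Re (cnj c * sphere_L2_cinner u v)"
proof -
  have "sphere_L2_cinner u (c *\<^sub>C v) = cnj c * sphere_L2_cinner u v"
  proof transfer
    fix u v :: "(real^'a) \<times> (real^'a) \<Rightarrow> complex" and c
    have "(\<lambda>z. u z * cnj (c * v z)) = (\<lambda>z. cnj c * (u z * cnj (v z)))"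
      by (simp add: mult_ac)
    then show "(\<integral>z. u z * cnj (c * v z) \<partial>sphere2_measure) = cnj c * (\<integral>z. u z * cnj (v z) \<partial>sphere2_measure)"
      by (simp only: integral_mult_right_zero)
  qed
  then show ?thesis
    by (simp add: inner_sphere_L2_def)
qed

lemma scaleC_add_left: "(a + b) *\<^sub>C u = a *\<^sub>C u + b *\<^sub>C u"
  by transfer (auto simp: L2_rel_def distrib_right intro!: square_integrable_add square_integrable_cmult)

lemma scaleC_of_real: "of_real r *\<^sub>C u = r *\<^sub>R u"
  by (simp add: scaleR_sphere_L2_def)

lemma scaleC_0 [simp]: "0 *\<^sub>C u = 0"
  using scaleC_of_real[of 0 u] by simp

lemma scaleC_scaleC: "a *\<^sub>C b *\<^sub>C u = (a * b) *\<^sub>C u"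
  by transfer (auto simp: L2_rel_def mult.assoc intro!: square_integrable_cmult)

lemma scaleC_diff_left: "(a - b) *\<^sub>C u = a *\<^sub>C u - b *\<^sub>C u"
  using scaleC_add_left[of "a - b" b u] by simp

lemma scaleC_eq_scaleR: "c *\<^sub>C u = Re c *\<^sub>R u + Im c *\<^sub>R (\<i> *\<^sub>C u)"
proof -
  have "c *\<^sub>C u = (of_real (Re c) + of_real (Im c) * \<i>) *\<^sub>C u"
    by (simp add: complex_eq[symmetric] mult.commute)
  then show ?thesis
    by (simp only: scaleC_add_left scaleC_of_real scaleC_scaleC[symmetric])
qed

text \<open>The imaginary part of <u, v> is the real part of <u, i v>. Linearity and continuity of
  the complex product are thus inherited from the real inner product.\<close>

lemma cinner_eq_inner: "sphere_L2_cinner u v = Complex (inner u v) (inner u (\<i> *\<^sub>C v))"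
  by (rule complex_eqI) (simp_all add: inner_scaleC_right, simp add: inner_sphere_L2_def)

lemma norm_scaleC: "norm (c *\<^sub>C u) = cmod c * norm u"
proof -
  have "norm (c *\<^sub>C u) = sqrt ((cmod c)\<^sup>2) * norm u"
    by transfer (simp add: norm_mult power_mult_distrib real_sqrt_mult)
  then show ?thesis
    by simp
qed

lemma cinner_diff_left: "sphere_L2_cinner (u - v) w = sphere_L2_cinner u w - sphere_L2_cinner v w"
  by (simp add: cinner_eq_inner inner_diff_left complex_eq_iff)

lemma cinner_sum_left: "sphere_L2_cinner (\<Sum>i\<in>I. u i) w = (\<Sum>i\<in>I. sphere_L2_cinner (u i) w)"
  by (simp add: cinner_eq_inner inner_sum_left complex_eq_iff)

lemma cinner_scaleC_left: "sphere_L2_cinner (c *\<^sub>C u) v = c * sphere_L2_cinner u v"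
  by transfer (simp add: mult.assoc)

lemma abs_sphere_L2_sum:
  fixes F :: "'i \<Rightarrow> (real^'n) \<times> (real^'n) \<Rightarrow> complex"
  assumes "finite I" "\<And>i. i \<in> I \<Longrightarrow> square_integrable sphere2_measure (F i)"
  shows "abs_sphere_L2 (\<lambda>z. \<Sum>i\<in>I. c i * F i z) = (\<Sum>i\<in>I. c i *\<^sub>C abs_sphere_L2 (F i))"
  using assms
proof (induction I rule: finite_induct)
  case empty
  then show ?case
    by (simp add: zero_sphere_L2_def)
next
  case (insert i I)
  then have sq: "square_integrable sphere2_measure (\<lambda>z. \<Sum>i\<in>I. c i * F i z)"
    "square_integrable sphere2_measure (F i)"
    by (auto intro!: square_integrable_sum square_integrable_cmult)
  have "abs_sphere_L2 (\<lambda>z. \<Sum>i\<in>insert i I. c i * F i z) =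
      abs_sphere_L2 (\<lambda>z. c i * F i z + (\<Sum>i\<in>I. c i * F i z))"
    using insert.hyps by simp
  also have "\<dots> = c i *\<^sub>C abs_sphere_L2 (F i) + abs_sphere_L2 (\<lambda>z. \<Sum>i\<in>I. c i * F i z)"
    using sq by (simp add: sphere_L2_scaleC.abs_eq plus_sphere_L2.abs_eq L2_rel_refl_iff square_integrable_cmult)
  finally show ?case
    using insert by simp
qed

lemma cinner_tensor_L2:
  fixes f g f' g' :: "real^'n \<Rightarrow> complex"
  assumes "continuous_on (sphere 0 1) f" "continuous_on (sphere 0 1) g"
    "continuous_on (sphere 0 1) f'" "continuous_on (sphere 0 1) g'"
  shows "sphere_L2_cinner (tensor_L2 f g) (tensor_L2 f' g') =
    (\<integral>x. f x * cnj (f' x) \<partial>sphere_measure) * (\<integral>x. g x * cnj (g' x) \<partial>sphere_measure)"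
proof -
  let ?F = "\<lambda>(x, y). f x * g y" and ?G = "\<lambda>(x, y). f' x * g' y"
  have sq: "square_integrable sphere2_measure ?F" "square_integrable sphere2_measure ?G"
    by (intro continuous_square_integrable_sphere2 continuous_on_tensor assms)+
  then have "sphere_L2_cinner (tensor_L2 f g) (tensor_L2 f' g') = (\<integral>z. ?F z * cnj (?G z) \<partial>sphere2_measure)"
    by (simp add: tensor_L2_def sphere_L2_cinner.abs_eq L2_rel_refl_iff)
  also have "\<dots> = (\<integral>x. (\<integral>y. ?F (x, y) * cnj (?G (x, y)) \<partial>sphere_measure) \<partial>sphere_measure)"
    by (rule sphere2.integral_fst'[symmetric]) (rule square_integrable_mult_cnj[OF sq])
  also have "\<dots> = (\<integral>x. (\<integral>y. (f x * cnj (f' x)) * (g y * cnj (g' y)) \<partial>sphere_measure) \<partial>sphere_measure)"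
    by (simp add: mult_ac)
  finally show ?thesis
    by simp
qed


section \<open>The spectral projection\<close>

lemma trunc_indices_eq:
  "trunc_indices d L = (SIGMA l:{..L}. {1..harmonic_dim d l}) \<times> (SIGMA l:{..L}. {1..harmonic_dim d l})"
  by (auto simp: trunc_indices_def)

lemma finite_trunc_indices [simp]: "finite (trunc_indices d L)"
  by (simp add: finite_card_trunc_indices)

lemma trunc_indices_mono: "L \<le> L' \<Longrightarrow> trunc_indices d L \<subseteq> trunc_indices d L'"
  by (auto simp: trunc_indices_def)

lemma synthesis_diff: "synthesis Y L c - synthesis Y L c' = synthesis Y L (\<lambda>i. c i - c' i)"
  by (simp add: synthesis_def scaleC_diff_left sum_subtractf)

lemma synthesis_extend:
  fixes Y :: "nat \<Rightarrow> nat \<Rightarrow> real^'n \<Rightarrow> complex"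
  assumes "L \<le> L'"
  shows "synthesis Y L c = synthesis Y L' (\<lambda>i. if i \<in> trunc_indices CARD('n) L then c i else 0)"
  unfolding synthesis_def
  by (rule sum.mono_neutral_cong_left) (use trunc_indices_mono[OF assms] in auto)

context
  fixes Y :: "nat \<Rightarrow> nat \<Rightarrow> real^'n \<Rightarrow> complex"
  assumes basis: "harmonic_basis Y" and dim: "CARD('n) \<ge> 2"
begin

lemma spherical_harmonic_basis: "m \<in> {1..harmonic_dim CARD('n) l} \<Longrightarrow> spherical_harmonic l (Y l m)"
  using basis by (simp add: harmonic_basis_def Let_def)

lemma harmonic_basis_continuous_on:
  "m \<in> {1..harmonic_dim CARD('n) l} \<Longrightarrow> continuous_on (sphere 0 1) (Y l m)"
  by (rule spherical_harmonic_continuous_on[OF spherical_harmonic_basis])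

lemma harmonic_basis_orthonormal:
  assumes "m \<in> {1..harmonic_dim CARD('n) l}" "m' \<in> {1..harmonic_dim CARD('n) l'}"
  shows "(\<integral>x. Y l m x * cnj (Y l' m' x) \<partial>sphere_measure) = (if (l, m) = (l', m') then 1 else 0)"
proof (cases "l = l'")
  case True
  then show ?thesis
    using basis assms by (simp add: harmonic_basis_def Let_def)
next
  case False
  then show ?thesis
    using spherical_harmonic_orthogonal[OF spherical_harmonic_basis spherical_harmonic_basis False dim] assms
    by simp
qed

lemma basis_L2_orthonormal:
  assumes "i \<in> trunc_indices CARD('n) L" "k \<in> trunc_indices CARD('n) L"
  shows "sphere_L2_cinner (basis_L2 Y i) (basis_L2 Y k) = (if i = k then 1 else 0)"
proof -
  obtain l1 m1 l2 m2 where i: "i = ((l1, m1), (l2, m2))"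
    "m1 \<in> {1..harmonic_dim CARD('n) l1}" "m2 \<in> {1..harmonic_dim CARD('n) l2}"
    using assms(1) by (auto simp: trunc_indices_def)
  obtain l1' m1' l2' m2' where k: "k = ((l1', m1'), (l2', m2'))"
    "m1' \<in> {1..harmonic_dim CARD('n) l1'}" "m2' \<in> {1..harmonic_dim CARD('n) l2'}"
    using assms(2) by (auto simp: trunc_indices_def)
  show ?thesis
    using i(2,3) k(2,3) unfolding i(1) k(1) basis_L2.simps
    by (subst cinner_tensor_L2) (auto simp: harmonic_basis_continuous_on harmonic_basis_orthonormal)
qed

lemma norm_basis_L2: "i \<in> trunc_indices CARD('n) L \<Longrightarrow> norm (basis_L2 Y i) = 1"
  using Re_cinner_self[of "basis_L2 Y i"] basis_L2_orthonormal[of i L i]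
  by (simp add: power2_eq_1_iff) (metis norm_ge_zero not_one_le_zero neg_0_le_iff_le)

lemma cinner_synthesis_basis_L2:
  assumes "k \<in> trunc_indices CARD('n) L"
  shows "sphere_L2_cinner (synthesis Y L c) (basis_L2 Y k) = c k"
proof -
  have "sphere_L2_cinner (synthesis Y L c) (basis_L2 Y k) =
      (\<Sum>i\<in>trunc_indices CARD('n) L. c i * (if i = k then 1 else 0))"
    unfolding synthesis_def cinner_sum_left cinner_scaleC_left
    by (intro sum.cong refl) (simp add: basis_L2_orthonormal[OF _ assms])
  also have "\<dots> = c k"
    using assms by (simp add: if_distrib cong: if_cong)
  finally show ?thesis .
qed

text \<open>The residual is orthogonal to every complex multiple of the basis elements up to L,
  hence to the difference \<open>q\<close> of the two candidates, and Pythagoras applies.\<close>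

lemma norm_spectral_projection_le:
  "norm (f - synthesis Y L (encoder Y L f)) \<le> norm (f - synthesis Y L c)"
proof -
  let ?p = "synthesis Y L (encoder Y L f)"
  define q where "q = ?p - synthesis Y L c"
  have "inner (f - ?p) (a *\<^sub>C basis_L2 Y i) = 0" if "i \<in> trunc_indices CARD('n) L" for a i
    using that
    by (simp add: inner_scaleC_right cinner_diff_left cinner_synthesis_basis_L2 encoder_def harmonic_coeff_def)
  then have "inner (f - ?p) q = 0"
    unfolding q_def synthesis_diff unfolding synthesis_def by (simp add: inner_sum_right)
  then have "(norm (f - ?p + q))\<^sup>2 = (norm (f - ?p))\<^sup>2 + (norm q)\<^sup>2"
    by (intro norm_add_Pythagorean) (simp add: orthogonal_def)
  then have "(norm (f - ?p))\<^sup>2 \<le> (norm (f - ?p + q))\<^sup>2"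
    by simp
  then have "norm (f - ?p) \<le> norm (f - ?p + q)"
    by (rule power2_le_imp_le) simp
  then show ?thesis
    by (simp add: q_def)
qed

section \<open>Density of finite combinations of basis products\<close>

lemma range_synthesis_add:
  assumes "u = synthesis Y L c" "v = synthesis Y L' c'"
  shows "\<exists>L c. u + v = synthesis Y L c"
proof -
  let ?L = "max L L'"
  obtain b b' where "u = synthesis Y ?L b" "v = synthesis Y ?L b'"
    using synthesis_extend[of L ?L Y c] synthesis_extend[of L' ?L Y c'] assms by auto
  then have "u + v = synthesis Y ?L (\<lambda>i. b i + b' i)"
    by (simp add: synthesis_def scaleC_add_left sum.distrib)
  then show ?thesis
    by blast
qed

lemma range_synthesis_sum:
  assumes "finite I" "\<And>i. i \<in> I \<Longrightarrow> \<exists>L c. u i = synthesis Y L c"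
  shows "\<exists>L c. (\<Sum>i\<in>I. u i) = synthesis Y L c"
  using assms
proof (induction I rule: finite_induct)
  case empty
  have "0 = synthesis Y 0 (\<lambda>i. 0)"
    by (simp add: synthesis_def)
  then show ?case
    by (metis sum.empty)
next
  case (insert i I)
  then show ?case
    by (auto intro: range_synthesis_add)
qed

lemma range_synthesis_basis_L2:
  assumes "i \<in> trunc_indices CARD('n) L"
  shows "\<exists>L c. a *\<^sub>C basis_L2 Y i = synthesis Y L c"
proof -
  have "synthesis Y L (\<lambda>k. if k = i then a else 0) =
      (\<Sum>k\<in>trunc_indices CARD('n) L. if k = i then a *\<^sub>C basis_L2 Y i else 0)"
    unfolding synthesis_def by (intro sum.cong) auto
  then show ?thesis
    using assms by (intro exI) (auto dest: sym)
qed

text \<open>The spanning clause of \<open>harmonic_basis\<close> expands both factors of a product;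
  multiplying out gives basis products of degree at most \<open>max l k\<close>.\<close>

lemma tensor_span_range_synthesis:
  "tensor_span F \<Longrightarrow> \<exists>L c. abs_sphere_L2 F = synthesis Y L c"
proof (induction rule: tensor_span.induct)
  case (prod l f k g F)
  let ?J = "\<lambda>l. {1..harmonic_dim CARD('n) l}"
  obtain a b where a: "\<And>x. x \<in> sphere 0 1 \<Longrightarrow> f x = (\<Sum>j\<in>?J l. a j * Y l j x)"
    and b: "\<And>x. x \<in> sphere 0 1 \<Longrightarrow> g x = (\<Sum>j\<in>?J k. b j * Y k j x)"
    using basis prod(1,2) unfolding harmonic_basis_def Let_def by meson
  let ?H = "\<lambda>i :: nat \<times> nat. \<lambda>(x, y). Y l (fst i) x * Y k (snd i) y"
  have "tensor_span F"
    using prod by (rule tensor_span.prod)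
  then have "square_integrable sphere2_measure F"
    by (intro continuous_square_integrable_sphere2 tensor_span_continuous_on)
  then have "abs_sphere_L2 F = abs_sphere_L2 (\<lambda>z. \<Sum>i\<in>?J l \<times> ?J k. (a (fst i) * b (snd i)) * ?H i z)"
    by (rule abs_sphere_L2_cong)
       (simp add: prod(3) a b sum_product sum.cartesian_product case_prod_unfold mult_ac)
  also have "\<dots> = (\<Sum>i\<in>?J l \<times> ?J k. (a (fst i) * b (snd i)) *\<^sub>C abs_sphere_L2 (?H i))"
    by (intro abs_sphere_L2_sum continuous_square_integrable_sphere2 continuous_on_tensor
        harmonic_basis_continuous_on) auto
  also have "\<dots> = (\<Sum>i\<in>?J l \<times> ?J k. (a (fst i) * b (snd i)) *\<^sub>C basis_L2 Y ((l, fst i), (k, snd i)))"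
    by (simp add: tensor_L2_def)
  finally show ?case
    using range_synthesis_sum[of "?J l \<times> ?J k"
        "\<lambda>i. (a (fst i) * b (snd i)) *\<^sub>C basis_L2 Y ((l, fst i), (k, snd i))"]
      range_synthesis_basis_L2[of _ "max l k"]
    by (auto simp: trunc_indices_def)
next
  case (add F G H)
  have sq: "square_integrable sphere2_measure F" "square_integrable sphere2_measure G"
    using add by (auto intro: continuous_square_integrable_sphere2 tensor_span_continuous_on)
  have "abs_sphere_L2 H = abs_sphere_L2 (\<lambda>z. F z + G z)"
    by (rule abs_sphere_L2_cong[symmetric]) (auto intro: square_integrable_add sq simp: add.hyps)
  also have "\<dots> = abs_sphere_L2 F + abs_sphere_L2 G"
    using sq by (simp add: plus_sphere_L2.abs_eq L2_rel_refl_iff)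
  finally show ?case
    using add.IH range_synthesis_add by metis
qed

lemma synthesis_dense:
  fixes u :: "'n sphere_L2"
  assumes "\<epsilon> > 0"
  shows "\<exists>L c. norm (u - synthesis Y L c) < \<epsilon>"
proof -
  obtain f where f: "square_integrable sphere2_measure f" "u = abs_sphere_L2 f"
    by (rule sphere_L2_cases)
  obtain g where g: "tensor_span g" "square_integrable sphere2_measure g"
    "(\<integral>x. (cmod (f x - g x))\<^sup>2 \<partial>sphere2_measure) < \<epsilon>\<^sup>2"
    using L2_approximableE[OF tensor_span_dense[OF dim f(1)], of "\<epsilon>\<^sup>2"] assms by auto
  have "norm (u - abs_sphere_L2 g) = sqrt (\<integral>x. (cmod (f x - g x))\<^sup>2 \<partial>sphere2_measure)"
    using f g square_integrable_diff[OF f(1) g(2)]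
    by (simp add: minus_sphere_L2.abs_eq norm_sphere_L2.abs_eq L2_rel_refl_iff)
  also have "\<dots> < \<epsilon>"
    using g(3) assms by (intro real_less_lsqrt) auto
  finally show ?thesis
    using tensor_span_range_synthesis[OF g(1)] by metis
qed

text \<open>Provides the measurability of the error that the essential supremum asks for. Splitting
  complex scalars into real and imaginary parts expresses the projection by real inner
  products.\<close>

lemma continuous_on_spectral_projection: "continuous_on UNIV (\<lambda>f. synthesis Y L (encoder Y L f))"
proof -
  have eq: "(\<lambda>f. synthesis Y L (encoder Y L f)) = (\<lambda>f. \<Sum>i\<in>trunc_indices CARD('n) L.
      inner f (basis_L2 Y i) *\<^sub>R basis_L2 Y i + inner f (\<i> *\<^sub>C basis_L2 Y i) *\<^sub>R (\<i> *\<^sub>C basis_L2 Y i))"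
    unfolding synthesis_def
    by (intro ext sum.cong refl, subst scaleC_eq_scaleR)
       (simp add: encoder_def harmonic_coeff_def cinner_eq_inner)
  show ?thesis
    unfolding eq by (intro continuous_intros)
qed

text \<open>For large L' the error at L is a finite piece of the expansion, bounded by
  \<open>T\<close>, plus the error at L'. The latter is below \<epsilon> because the projection is
  at least as good as the approximant given by density.\<close>

lemma spectral_error_le_tail:
  fixes f :: "'n sphere_L2"
  assumes "\<And>L'. (\<Sum>i\<in>trunc_indices CARD('n) L' - trunc_indices CARD('n) L. cmod (harmonic_coeff Y f i)) \<le> T"
  shows "norm (synthesis Y L (encoder Y L f) - f) \<le> T"
proof (rule field_le_epsilon)
  fix \<epsilon> :: real assume "\<epsilon> > 0"
  then obtain L1 c where "norm (f - synthesis Y L1 c) < \<epsilon>"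
    using synthesis_dense by blast
  \<comment> \<open>Large enough both to contain the approximant of level \<open>L1\<close> and to
    make the truncations nested.\<close>
  moreover define L' where "L' = max L L1"
  ultimately obtain c' where c': "norm (f - synthesis Y L' c') < \<epsilon>"
    using synthesis_extend[of L1 L' Y c] by auto
  let ?I = "\<lambda>L. trunc_indices CARD('n) L"
  have "synthesis Y L' (encoder Y L' f) - synthesis Y L (encoder Y L f) =
      (\<Sum>i\<in>?I L' - ?I L. harmonic_coeff Y f i *\<^sub>C basis_L2 Y i)"
    using trunc_indices_mono[of L L' "CARD('n)"]
    by (simp add: synthesis_def encoder_def sum_diff L'_def)
  then have "norm (synthesis Y L' (encoder Y L' f) - synthesis Y L (encoder Y L f))
      \<le> (\<Sum>i\<in>?I L' - ?I L. cmod (harmonic_coeff Y f i))"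
    by (simp only:) (rule sum_norm_le, use norm_basis_L2 in \<open>auto simp: norm_scaleC\<close>)
  also have "\<dots> \<le> T"
    by (rule assms)
  finally have "norm (synthesis Y L (encoder Y L f) - f) \<le> T + norm (f - synthesis Y L' (encoder Y L' f))"
    using norm_triangle_ineq[of "synthesis Y L' (encoder Y L' f) - synthesis Y L (encoder Y L f)"
        "f - synthesis Y L' (encoder Y L' f)"]
    by (simp add: norm_minus_commute[of f])
  also have "\<dots> \<le> T + \<epsilon>"
    using norm_spectral_projection_le[of f L' c'] c' by simp
  finally show "norm (synthesis Y L (encoder Y L f) - f) \<le> T + \<epsilon>" .
qed

end


section \<open>Exponential decay\<close>

text \<open>Since 2 l + 1 = 2 (l + 1) - 1, this is a combination of the geometric series and its
  derivative. The weight 2 l + 1 dominates \<open>harmonic_dim\<close> for every d.\<close>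

lemma summable_linear_geometric:
  fixes q :: real
  assumes "0 \<le> q" "q < 1"
  shows "summable (\<lambda>l. (2 * real l + 1) * q ^ l)"
proof -
  have "summable (\<lambda>l. real (Suc l) * q ^ l)"
    using geometric_deriv_sums[of q] assms by (intro sums_summable) auto
  then have "summable (\<lambda>l. 2 * (real (Suc l) * q ^ l) - q ^ l)"
    using assms by (intro summable_diff summable_mult summable_geometric) auto
  then show ?thesis
    by (simp add: algebra_simps)
qed

text \<open>The exponential is split into two equal factors q ^ (l1 + l2) with q = exp (-\<sigma> /
  2). Outside the truncation one is at most q ^ L; the other, summed with multiplicities, factors
  into the square of a single sum bounded by the convergent series \<open>S\<close>.\<close>

lemma sum_trunc_indices_exp_le:
  fixes \<sigma> :: real
  assumes "\<sigma> > 0"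
  obtains B where "B > 0" "\<And>d L L'. (\<Sum>i\<in>trunc_indices d L' - trunc_indices d L.
      exp (- \<sigma> * real (fst (fst i) + fst (snd i)))) \<le> B * exp (- \<sigma> / 2 * real L)"
proof -
  define q where "q = exp (- \<sigma> / 2)"
  have q: "0 < q" "q < 1"
    using assms by (auto simp: q_def)
  define S where "S = (\<Sum>l. (2 * real l + 1) * q ^ l)"
  have summ: "summable (\<lambda>l. (2 * real l + 1) * q ^ l)"
    using q by (intro summable_linear_geometric) auto
  have "S > 0"
    unfolding S_def using q by (intro suminf_pos summ) auto
  have qpow: "exp (- \<sigma> / 2 * real l) = q ^ l" for l
    by (simp add: q_def mult.commute flip: exp_of_nat_mult)
  show thesis
  proof
    show "S\<^sup>2 > 0"
      using \<open>S > 0\<close> by simp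
    fix d L L' :: nat
    have le: "exp (- \<sigma> * real (l1 + l2)) \<le> q ^ L * (q ^ l1 * q ^ l2)"
      if "((l1, m1), (l2, m2)) \<in> trunc_indices d L' - trunc_indices d L" for l1 m1 l2 m2
    proof -
      have "L \<le> l1 + l2"
        using that by (auto simp: trunc_indices_def)
      then have "q ^ (l1 + l2) \<le> q ^ L"
        using q by (intro power_decreasing) auto
      then have "q ^ (l1 + l2) * q ^ (l1 + l2) \<le> q ^ L * q ^ (l1 + l2)"
        using q by (intro mult_right_mono) auto
      moreover have "exp (- \<sigma> * real (l1 + l2)) = q ^ (l1 + l2) * q ^ (l1 + l2)"
        by (simp add: algebra_simps flip: qpow exp_add)
      ultimately show ?thesis
        by (simp add: power_add)
    qed
    let ?w = "\<lambda>i :: harmonic_index. q ^ fst (fst i) * q ^ fst (snd i)"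
    let ?D = "SIGMA l:{..L'}. {1..harmonic_dim d l}"
    have "(\<Sum>i\<in>trunc_indices d L' - trunc_indices d L. exp (- \<sigma> * real (fst (fst i) + fst (snd i))))
        \<le> (\<Sum>i\<in>trunc_indices d L' - trunc_indices d L. q ^ L * ?w i)"
      using le by (intro sum_mono) auto
    also have "\<dots> \<le> (\<Sum>i\<in>trunc_indices d L'. q ^ L * ?w i)"
      using q by (intro sum_mono2) auto
    also have "\<dots> = q ^ L * (\<Sum>i\<in>trunc_indices d L'. ?w i)"
      by (simp only: sum_distrib_left)
    also have "(\<Sum>i\<in>trunc_indices d L'. ?w i) = (\<Sum>i\<in>?D. q ^ fst i)\<^sup>2"
      by (simp add: trunc_indices_eq power2_eq_square sum_product sum.cartesian_product case_prod_unfold)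
    also have "(\<Sum>i\<in>?D. q ^ fst i) = (\<Sum>l\<le>L'. \<Sum>m\<in>{1..harmonic_dim d l}. q ^ l)"
      by (subst sum.Sigma) (simp_all add: case_prod_unfold)
    also have "\<dots> = (\<Sum>l\<le>L'. real (harmonic_dim d l) * q ^ l)"
      by simp
    also have "q ^ L * (\<Sum>l\<le>L'. real (harmonic_dim d l) * q ^ l)\<^sup>2 \<le> q ^ L * S\<^sup>2"
    proof (intro mult_left_mono power_mono)
      have "(\<Sum>l\<le>L'. real (harmonic_dim d l) * q ^ l) \<le> (\<Sum>l\<le>L'. (2 * real l + 1) * q ^ l)"
        using q by (intro sum_mono mult_right_mono) (auto simp: harmonic_dim_def)
      also have "\<dots> \<le> S"
        unfolding S_def using q by (intro sum_le_suminf summ) auto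
      finally show "(\<Sum>l\<le>L'. real (harmonic_dim d l) * q ^ l) \<le> S" .
    qed (use q in \<open>auto intro!: sum_nonneg\<close>)
    finally show "(\<Sum>i\<in>trunc_indices d L' - trunc_indices d L.
        exp (- \<sigma> * real (fst (fst i) + fst (snd i)))) \<le> S\<^sup>2 * exp (- \<sigma> / 2 * real L)"
      by (simp only: qpow mult.commute[of "S\<^sup>2"])
  qed
qed

section \<open>Growth of the encoder dimension\<close>

lemma power_powr_root:
  fixes t :: real
  assumes "t > 0" "d \<ge> 2"
  shows "(t ^ (2 * (d - 1))) powr (1 / (2 * (real d - 1))) = t"
  using assms by (simp add: powr_powr of_nat_diff flip: powr_realpow)

text \<open>The dimension is 2 (2 L + 1)^2 for d = 2 and 2 (L + 1)^4 for d = 3. The value 4 L + 2 is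
  a common bound for both roots.\<close>

lemma real_enc_dim_root_le:
  assumes "d = 2 \<or> d = 3"
  shows "real (real_enc_dim d L) powr (1 / (2 * (real d - 1))) \<le> 4 * real L + 2"
proof -
  have dims: "(\<Sum>l\<le>L. harmonic_dim 2 l) = 2 * L + 1" "(\<Sum>l\<le>L. harmonic_dim 3 l) = (L + 1)\<^sup>2"
    by (induction L) (auto simp: harmonic_dim_def power2_eq_square)
  have "real (real_enc_dim d L) \<le> (4 * real L + 2) ^ (2 * (d - 1))"
    using assms
  proof
    assume "d = 2"
    then show ?thesis
      by (simp add: real_enc_dim_def complex_enc_dim_def dims power2_eq_square algebra_simps)
  next
    assume d: "d = 3"
    have "2 * (real L + 1) ^ 4 \<le> 2 ^ 4 * (real L + 1) ^ 4"
      by simp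
    also have "\<dots> = (2 * real L + 2) ^ 4"
      unfolding power_mult_distrib[symmetric] by (simp add: algebra_simps)
    also have "\<dots> \<le> (4 * real L + 2) ^ 4"
      by (intro power_mono) auto
    finally show ?thesis
      using d by (simp add: real_enc_dim_def complex_enc_dim_def dims add.commute flip: power_mult)
  qed
  then have "real (real_enc_dim d L) powr (1 / (2 * (real d - 1))) \<le>
      ((4 * real L + 2) ^ (2 * (d - 1))) powr (1 / (2 * (real d - 1)))"
    using assms by (intro powr_mono2) auto
  also have "\<dots> = 4 * real L + 2"
    using assms by (intro power_powr_root) auto
  finally show ?thesis .
qed

theorem theorem4p2:
  fixes Y :: "nat \<Rightarrow> nat \<Rightarrow> real^'n \<Rightarrow> complex"
    and V :: "'n sphere_L2 set"
    and N :: "'n sphere_L2 \<Rightarrow> real"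
    and \<mu> :: "'n sphere_L2 measure"
    and M :: real
    and d :: nat
  defines "d \<equiv> CARD('n)"
  assumes "d \<in> {2, 3}"
    and "harmonic_basis Y"
    and "analytic_class Y V N"
    and "prob_space \<mu>"
    and "sets \<mu> = sets borel"
    and "M > 0"
    and "AE f in \<mu>. f \<in> V \<and> N f \<le> M"
  shows "\<exists>C1>0. \<exists>c1>0.
    (\<forall>L. spectral_error \<mu> Y L
        \<le> ereal (C1 * exp (- c1 * real (real_enc_dim d L) powr (1 / (2 * (real d - 1)))))) \<and>
    (\<forall>\<epsilon>>0. \<forall>L. real (real_enc_dim d L) \<ge> (1 / c1 * ln (C1 / \<epsilon>)) ^ (2 * (d - 1)) \<longrightarrow>
        spectral_error \<mu> Y L \<le> ereal \<epsilon>)"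
proof -
  have d: "d = 2 \<or> d = 3" and dim: "CARD('n) \<ge> 2"
    using assms(2) by (auto simp: d_def)
  obtain C \<sigma> where "C > 0" "\<sigma> > 0" and decay: "\<And>f l1 l2 m1 m2. f \<in> V \<Longrightarrow>
      m1 \<in> {1..harmonic_dim d l1} \<Longrightarrow> m2 \<in> {1..harmonic_dim d l2} \<Longrightarrow>
      cmod (harmonic_coeff Y f ((l1, m1), (l2, m2))) \<le> C * N f * exp (- \<sigma> * real (l1 + l2))"
    using assms(4) unfolding analytic_class_def d_def by blast
  obtain B where "B > 0" and B: "\<And>d L L'. (\<Sum>i\<in>trunc_indices d L' - trunc_indices d L.
      exp (- \<sigma> * real (fst (fst i) + fst (snd i)))) \<le> B * exp (- \<sigma> / 2 * real L)"
    using sum_trunc_indices_exp_le[OF \<open>\<sigma> > 0\<close>] by blast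
  \<comment> \<open>With c1 = \<sigma> / 8 one has c1 (4 L + 2) = \<sigma> L / 2 + \<sigma> / 4: the
    first term is the tail rate, the second is compensated by exp (\<sigma> / 4).\<close>
  define C1 where "C1 = C * M * B * exp (\<sigma> / 4)"
  define c1 where "c1 = \<sigma> / 8"
  have pos: "C1 > 0" "c1 > 0"
    using \<open>C > 0\<close> \<open>M > 0\<close> \<open>B > 0\<close> \<open>\<sigma> > 0\<close> by (auto simp: C1_def c1_def)
  have bound: "norm (synthesis Y L (encoder Y L f) - f) \<le> C * M * (B * exp (- \<sigma> / 2 * real L))"
    if f: "f \<in> V" "N f \<le> M" for f L
  proof (rule spectral_error_le_tail[OF assms(3) dim])
    fix L'
    have "cmod (harmonic_coeff Y f i) \<le> C * M * exp (- \<sigma> * real (fst (fst i) + fst (snd i)))"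
      if i_mem: "i \<in> trunc_indices d L' - trunc_indices d L" for i
    proof -
      obtain l1 m1 l2 m2 where i: "i = ((l1, m1), (l2, m2))"
        "m1 \<in> {1..harmonic_dim d l1}" "m2 \<in> {1..harmonic_dim d l2}"
        using i_mem unfolding trunc_indices_def by blast
      have "cmod (harmonic_coeff Y f i) \<le> C * N f * exp (- \<sigma> * real (l1 + l2))"
        using decay[OF f(1) i(2,3)] by (simp only: i(1))
      also have "\<dots> \<le> C * M * exp (- \<sigma> * real (l1 + l2))"
        using f(2) \<open>C > 0\<close> by (intro mult_right_mono mult_left_mono) auto
      finally show ?thesis
        by (simp add: i(1))
    qed
    then have "(\<Sum>i\<in>trunc_indices d L' - trunc_indices d L. cmod (harmonic_coeff Y f i)) \<le>
        (\<Sum>i\<in>trunc_indices d L' - trunc_indices d L.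
          C * M * exp (- \<sigma> * real (fst (fst i) + fst (snd i))))"
      by (rule sum_mono)
    also have "\<dots> \<le> C * M * (B * exp (- \<sigma> / 2 * real L))"
      unfolding sum_distrib_left[symmetric] using \<open>C > 0\<close> \<open>M > 0\<close> by (intro mult_left_mono B) simp
    finally show "(\<Sum>i\<in>trunc_indices CARD('n) L' - trunc_indices CARD('n) L. cmod (harmonic_coeff Y f i))
        \<le> C * M * (B * exp (- \<sigma> / 2 * real L))"
      by (simp only: d_def)
  qed
  have main: "spectral_error \<mu> Y L \<le>
      ereal (C1 * exp (- c1 * real (real_enc_dim d L) powr (1 / (2 * (real d - 1)))))" for L
  proof -
    have "c1 * real (real_enc_dim d L) powr (1 / (2 * (real d - 1))) \<le> c1 * (4 * real L + 2)"
      using real_enc_dim_root_le[OF d] pos by (intro mult_left_mono) auto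
    then have "exp (\<sigma> / 4) * exp (- c1 * real (real_enc_dim d L) powr (1 / (2 * (real d - 1)))) \<ge>
        exp (- \<sigma> / 2 * real L)"
      unfolding exp_add[symmetric] exp_le_cancel_iff by (simp add: c1_def algebra_simps)
    then have le: "C * M * (B * exp (- \<sigma> / 2 * real L)) \<le>
        C1 * exp (- c1 * real (real_enc_dim d L) powr (1 / (2 * (real d - 1))))"
      using \<open>C > 0\<close> \<open>M > 0\<close> \<open>B > 0\<close> unfolding C1_def mult.assoc
      by (intro mult_left_mono) auto
    show ?thesis
      unfolding spectral_error_def
    proof (rule esssup_I)
      have "(\<lambda>f. ereal (norm (synthesis Y L (encoder Y L f) - f))) \<in> borel_measurable borel"
        by (intro borel_measurable_ereal borel_measurable_continuous_onI continuous_intros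
            continuous_on_spectral_projection[OF assms(3) dim])
      then show "(\<lambda>f. ereal (norm (synthesis Y L (encoder Y L f) - f))) \<in> borel_measurable \<mu>"
        by (simp add: measurable_cong_sets[OF assms(6) refl])
      show "AE f in \<mu>. ereal (norm (synthesis Y L (encoder Y L f) - f)) \<le>
          ereal (C1 * exp (- c1 * real (real_enc_dim d L) powr (1 / (2 * (real d - 1)))))"
        using assms(8)
      proof eventually_elim
        case (elim f)
        then show ?case
          using order_trans[OF bound le] by simp
      qed
    qed
  qed
  have "spectral_error \<mu> Y L \<le> ereal \<epsilon>"
    if "\<epsilon> > 0" and m: "real (real_enc_dim d L) \<ge> (1 / c1 * ln (C1 / \<epsilon>)) ^ (2 * (d - 1))" for \<epsilon> L
  proof -
    let ?t = "1 / c1 * ln (C1 / \<epsilon>)" and ?r = "real (real_enc_dim d L) powr (1 / (2 * (real d - 1)))"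
    have "?t \<le> ?r"
    \<comment> \<open>The even power loses the sign of \<open>?t\<close>, so the root is taken only
      for positive \<open>?t\<close>; otherwise \<open>?r\<close> is larger because it is
      nonnegative.\<close>
    proof (cases "?t > 0")
      case True
      then have "?t = (?t ^ (2 * (d - 1))) powr (1 / (2 * (real d - 1)))"
        using d by (intro power_powr_root[symmetric]) auto
      also have "\<dots> \<le> ?r"
        using m True d by (intro powr_mono2) auto
      finally show ?thesis .
    next
      case False
      then show ?thesis
        using powr_ge_zero[of "real (real_enc_dim d L)"] by (meson linorder_not_less order_trans)
    qed
    then have "ln (C1 / \<epsilon>) \<le> c1 * ?r"
      using pos by (simp add: field_simps)
    then have "C1 / \<epsilon> \<le> exp (c1 * ?r)"
      using pos \<open>\<epsilon> > 0\<close> by (simp add: ln_le_cancel_iff flip: ln_exp) (metis exp_ln divide_pos_pos exp_le_cancel_iff)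
    then have "C1 * exp (- c1 * ?r) \<le> \<epsilon>"
      using \<open>\<epsilon> > 0\<close> by (simp add: exp_minus field_simps)
    then show ?thesis
      using main[of L] by (meson ereal_less_eq(3) order_trans)
  qed
  with main pos show ?thesis
    by blast
qed

end
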